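(* Let $D\in\mathcal{D}_d$, let $\lambda>0$, and let $f_0$ be a continuous strictly decreasing positive function on $[0,\infty)$ which varies regularly at $\infty$ with exponent $-(\lambda+d)$. Suppose the random vector $\mathbf X$ has a continuous density $f\sim f_0(n_D)$. Assume that for each coordinate $i\in\{1,\ldots,d\}$ the set $D$ contains a point whose $i$th component is positive. Then: (1) The components of $\mathbf X$ are asymptotically dependent unless $D$ is contained in the set $S$ of points of $\mathbb{R}^d$ with at most one positive coordinate. (2) Let $\mathbf X^{\vee n}$ denote the coordinatewise maximum of $n$ independent copies of $\mathbf X$. There are scaling constants $s_n>0$ such that $\mathbf X^{\vee n}/s_n$ converges in law to a vector $\mathbf W=(W_1,\ldots,W_d)$ whose components have distribution functions $\mathbb{P}\{W_i\le t\}=e^{-(a_i/t)^\lambda}$, $t>0$, for positive constants $a_1,\ldots,a_d$. The exponent measure $\rho^+$ of $\mathbf W$ is the image, under the map $\mathbf x\mapsto\mathbf x^+=(x_1\vee 0,\ldots,x_d\vee 0)$, of the measure $\rho$ with intensity $c/n_D^{\lambda+d}$ for some constant $c>0$, and one may take $c=1$ by a suitable choice of the scaling constants $s_n$.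
   Context: A set $D\subset\mathbb{R}^d$ is star-shaped if $\mathbf x\in D$ implies $r\mathbf x\in D$ for $0<r<1$. For a non-empty bounded open star-shaped set $D$, let $D_\infty=\bigcup_{n>0} nD$ (an open cone), with gauge function $n_D(\mathbf x)=\inf\{t>0:\mathbf x\in tD\}$ on $D_\infty$. $\mathcal{D}_d$ is the class of all (non-empty) bounded open star-shaped sets $D\subset\mathbb{R}^d$ for which $D_\infty$ is convex, $n_D$ is continuous on $D_\infty$, and $D=\{\mathbf x\in D_\infty: n_D(\mathbf x)<1\}$. The function $f_0(n_D)$ is set equal to $0$ off $D_\infty$. The relation $f\sim f_0(n_D)$ means asymptotic equality at infinity: $f$ vanishes off $D_\infty$, is continuous on $D_\infty$, and $f(\mathbf x)/f_0(n_D(\mathbf x))\to 1$ as $\|\mathbf x\|\to\infty$, $\mathbf x\in D_\infty$. A measurable $h:(0,\infty)\to(0,\infty)$ varies regularly at $\infty$ with exponent $\theta$ if $h(tx)/h(t)\to x^\theta$ as $t\to\infty$ for every $x>0$. The measure $\rho$ on $\mathbb{R}^d\setminus\{\mathbf 0\}$ has density $c/n_D(\mathbf x)^{\lambda+d}$ on $D_\infty \setminus\{\mathbf 0\}$ and $0$ elsewhere; $\rho^+$ is its image considered on $[0,\infty)^d\setminus\{\mathbf 0\}$. That $\rho^+$ is the exponent measure of $\mathbf W$ means $\mathbb{P}\{\mathbf W\le\mathbf w\}=\exp(-\rho^+([\mathbf 0,\mathbf w]^c))$ for $\mathbf w\in(0,\infty)^d$, the complement being taken in $[0,\infty)^d$.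 Asymptotic independence: let $(X,Y)$ have distribution function $F$ with continuous marginals $F_1,F_2$, and let $P$ be the function on $[0,1]^2$ determined by $P(F_1(x),F_2(y))=\mathbb{P}\{X>x,Y>y\}$ (equivalently $P(u,v)=1+C(u,v)-u-v$, $C$ the copula of $F$). $X$ and $Y$ are asymptotically independent if $P(1-s,1-s)=o(s)$ as $s\downarrow 0$. The components of a random vector in $\mathbb{R}^d$ are asymptotically independent if every two components are, and asymptotically dependent if they are not asymptotically independent (here, by (2), a max-stable limit law also exists). *)

theory Defs
  imports "HOL-Probability.Probability"
begin

section \<open>Star-shaped sets and their gauge functions\<close>

text \<open>
  The centre of the star is the origin, which need not belong to the set.
  This differs from the library notion \<^const>\<open>starlike\<close>, which requires a centre inside the set.
\<close>

definition star_shaped :: "'v::real_vector set \<Rightarrow> bool" where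
  "star_shaped D \<longleftrightarrow> (\<forall>x\<in>D. \<forall>r. 0 < r \<and> r < 1 \<longrightarrow> r *\<^sub>R x \<in> D)"

definition cone_of :: "'v::real_vector set \<Rightarrow> 'v set" where
  "cone_of D = (\<Union>n\<in>{0::nat<..}. (\<lambda>x. real n *\<^sub>R x) ` D)"

text \<open>The gauge is only meaningful on \<^term>\<open>cone_of D\<close>; elsewhere the infimum is over the empty set.\<close>

definition gauge_fun :: "'v::real_vector set \<Rightarrow> 'v \<Rightarrow> real" where
  "gauge_fun D x = Inf {t. 0 < t \<and> x \<in> (\<lambda>y. t *\<^sub>R y) ` D}"

definition shape_class :: "'v::real_normed_vector set set" where
  "shape_class = {D. D \<noteq> {} \<and> bounded D \<and> open D \<and> star_shaped D
      \<and> convex (cone_of D)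
      \<and> continuous_on (cone_of D) (gauge_fun D)
      \<and> D = {x \<in> cone_of D. gauge_fun D x < 1}}"


section \<open>Regular variation and asymptotic equality\<close>

definition regularly_varying :: "(real \<Rightarrow> real) \<Rightarrow> real \<Rightarrow> bool" where
  "regularly_varying h \<theta> \<longleftrightarrow>
     set_borel_measurable borel {0<..} h \<and> (\<forall>t>0. 0 < h t)
     \<and> (\<forall>x>0. ((\<lambda>t. h (t * x) / h t) \<longlongrightarrow> x powr \<theta>) at_top)"

text \<open>The relation \<open>f \<sim> f\<^sub>0(n\<^sub>D)\<close>. Continuity is required on the open cone only: \<open>f\<close> may jump at
  the boundary of the cone.\<close>

definition asymp_to_gauge ::
  "('v::real_normed_vector \<Rightarrow> real) \<Rightarrow> (real \<Rightarrow> real) \<Rightarrow> 'v set \<Rightarrow> bool" where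
  "asymp_to_gauge f f0 D \<longleftrightarrow>
     (\<forall>x. x \<notin> cone_of D \<longrightarrow> f x = 0)
     \<and> continuous_on (cone_of D) f
     \<and> ((\<lambda>x. f x / f0 (gauge_fun D x)) \<longlongrightarrow> 1) (inf at_infinity (principal (cone_of D)))"


section \<open>Asymptotic independence\<close>

text \<open>
  The function \<open>P\<close> with \<open>P(F\<^sub>1(x), F\<^sub>2(y)) = \<P>{X > x, Y > y}\<close> always exists, and when the marginal
  distribution functions \<open>F\<^sub>1\<close>, \<open>F\<^sub>2\<close> are continuous they attain every value in \<open>(0,1)\<close>, so that \<open>P\<close>
  is unique on the open unit square. The limit below only depends on values there.
\<close>

definition asymp_indep :: "'a measure \<Rightarrow> ('a \<Rightarrow> real) \<Rightarrow> ('a \<Rightarrow> real) \<Rightarrow> bool" where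
  "asymp_indep M X Y \<longleftrightarrow>
     (\<exists>P :: real \<Rightarrow> real \<Rightarrow> real.
        (\<forall>x y. P (cdf (distr M borel X) x) (cdf (distr M borel Y) y)
                 = measure M {\<omega> \<in> space M. x < X \<omega> \<and> y < Y \<omega>})
        \<and> (\<lambda>s. P (1 - s) (1 - s)) \<in> o[at_right 0](\<lambda>s. s))"

definition asymp_indep_components :: "'a measure \<Rightarrow> ('a \<Rightarrow> real ^ 'd) \<Rightarrow> bool" where
  "asymp_indep_components M X \<longleftrightarrow>
     (\<forall>i j. i \<noteq> j \<longrightarrow> asymp_indep M (\<lambda>\<omega>. X \<omega> $ i) (\<lambda>\<omega>. X \<omega> $ j))"

definition asymp_dep_components :: "'a measure \<Rightarrow> ('a \<Rightarrow> real ^ 'd) \<Rightarrow> bool" where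
  "asymp_dep_components M X \<longleftrightarrow> \<not> asymp_indep_components M X"


section \<open>Coordinatewise maxima and their limits in law\<close>

definition coord_max :: "nat \<Rightarrow> (nat \<Rightarrow> real ^ 'd) \<Rightarrow> real ^ 'd" where
  "coord_max n x = (\<chi> i. MAX k\<in>{..<n}. x k $ i)"

text \<open>
  The law of \<open>X\<^sup>\<or>\<^sup>n/s\<close> where \<open>X\<close> has law \<open>\<mu>\<close>: the coordinate projections of the \<open>n\<close>-fold product
  space are \<open>n\<close> independent copies of \<open>X\<close>. For \<open>n = 0\<close> the maximum is an irrelevant constant.
\<close>

definition scaled_max_law :: "(real ^ 'd) measure \<Rightarrow> nat \<Rightarrow> real \<Rightarrow> (real ^ 'd) measure" where
  "scaled_max_law \<mu> n s =
     distr (PiM {..<n} (\<lambda>_. \<mu>)) borel (\<lambda>x. (1 / s) *\<^sub>R coord_max n x)"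

definition converges_in_law ::
  "(nat \<Rightarrow> 'v::topological_space measure) \<Rightarrow> 'v measure \<Rightarrow> bool" where
  "converges_in_law \<mu> \<nu> \<longleftrightarrow>
     (\<forall>g :: 'v \<Rightarrow> real. continuous_on UNIV g \<and> bounded (range g) \<longrightarrow>
        (\<lambda>n. \<integral>x. g x \<partial>\<mu> n) \<longlonglongrightarrow> (\<integral>x. g x \<partial>\<nu>))"

text \<open>
  With \<open>X\<close> of law \<open>\<mu>\<close>: \<open>X\<^sup>\<or>\<^sup>n/s\<^sub>n\<close> converges in law to a vector \<open>W\<close> of law \<open>\<nu>\<close> which has Frechet
  marginals \<open>\<P>{W\<^sub>i \<le> t} = exp (- ((a\<^sub>i/t) powr lam))\<close>.
\<close>

definition frechet_max_limit ::
  "(real ^ 'd) measure \<Rightarrow> real \<Rightarrow> (nat \<Rightarrow> real) \<Rightarrow> ('d \<Rightarrow> real) \<Rightarrow> (real ^ 'd) measure \<Rightarrow> bool" where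
  "frechet_max_limit \<mu> lam s a \<nu> \<longleftrightarrow>
     (\<forall>n. 0 < s n) \<and> (\<forall>i. 0 < a i)
     \<and> prob_space \<nu> \<and> sets \<nu> = sets borel
     \<and> converges_in_law (\<lambda>n. scaled_max_law \<mu> n (s n)) \<nu>
     \<and> (\<forall>i. \<forall>t>0. measure \<nu> {w. w $ i \<le> t} = exp (- ((a i / t) powr lam)))"


section \<open>Exponent measures\<close>

definition pos_part_vec :: "real ^ 'd \<Rightarrow> real ^ 'd" where
  "pos_part_vec x = (\<chi> i. max (x $ i) 0)"

definition gauge_measure :: "(real ^ 'd) set \<Rightarrow> real \<Rightarrow> real \<Rightarrow> (real ^ 'd) measure" where
  "gauge_measure D lam c =
     density (restrict_space lborel (- {0}))
       (\<lambda>x. ennreal (if x \<in> cone_of D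
                      then c / gauge_fun D x powr (lam + real CARD('d)) else 0))"

text \<open>
  The order on \<^typ>\<open>real ^ 'd\<close> is componentwise, so that \<open>{0..}\<close> is the closed positive orthant.
  Its vertex is removed because the image measure may have infinite mass there.
\<close>

definition gauge_measure_pos :: "(real ^ 'd) set \<Rightarrow> real \<Rightarrow> real \<Rightarrow> (real ^ 'd) measure" where
  "gauge_measure_pos D lam c =
     restrict_space (distr (gauge_measure D lam c) borel pos_part_vec) ({0..} - {0})"

text \<open>\<open>\<rho>\<close> is the exponent measure of a vector with law \<open>\<nu>\<close>. Finiteness is stated separately since
  \<^const>\<open>measure\<close> maps sets of infinite measure to \<open>0\<close>.\<close>

definition is_exponent_measure :: "(real ^ 'd) measure \<Rightarrow> (real ^ 'd) measure \<Rightarrow> bool" where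
  "is_exponent_measure \<rho> \<nu> \<longleftrightarrow>
     (\<forall>w. (\<forall>i. 0 < w $ i) \<longrightarrow>
        emeasure \<rho> ({0..} - {0..w}) < \<infinity>
        \<and> measure \<nu> {..w} = exp (- measure \<rho> ({0..} - {0..w})))"

end

theory Submission
  imports Defs
begin

text \<open>
  After rescaling, the density of \<open>X\<close> converges pointwise: \<open>f(ty)/f\<^sub>0(t)\<close> tends to
  \<open>1/n\<^sub>D(y)\<close> to the power \<open>\<lambda> + d\<close> on the cone and to \<open>0\<close> off it. A Potter bound for \<open>f\<^sub>0\<close> and
  \<open>n\<^sub>D(y) \<ge> \<parallel>y\<parallel>/R\<close> give an integrable majorant away from the origin, so by dominated convergence
  \<open>\<P>{X \<in> tA} / (t\<^sup>d f\<^sub>0(t))\<close> tends to \<open>\<rho>(A)\<close> for every Borel set \<open>A\<close> bounded away from the origin. Choosing \<open>s\<^sub>n\<close>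
  with \<open>s\<^sub>n\<^sup>d f\<^sub>0(s\<^sub>n) = 1/n\<close>, the distribution functions of the scaled maxima converge to
  \<open>exp (- \<rho>({..w}\<^sup>c))\<close>. A vector with this distribution function is the coordinatewise supremum
  of a Poisson point process with intensity \<open>\<rho>\<close>, which is assembled from independent Poisson numbers
  of independent points in shells of finite mass.
\<close>

section \<open>Maxima of Poisson samples\<close>

text \<open>Everything rests on the sets \<open>{x. \<exists>i\<in>J. w i < x $ i}\<close> with
  positive thresholds: they avoid a neighbourhood of the origin and so have finite mass, while the
  intensity, homogeneous of degree \<open>- (lam + CARD('d))\<close>, is not integrable at the
  origin. Distribution functions of the maxima are therefore controlled only on the open positive
  orthant. This shapes the convergence proof: cells must stay inside that orthant, and the limit
  must be shown to be strictly positive almost surely, which follows from its Frechet marginals. A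
  pointwise limit of distribution functions is not yet a law; the Poisson construction supplies one,
  because \<open>exp (- \<rho> U)\<close> is the probability that no point falls in
  \<open>U\<close>. The index set \<open>J\<close> serves the joint law (\<open>J = UNIV\<close>)
  and the marginals (singletons) at once. For dependence, a point of \<open>D\<close> with two
  positive coordinates yields an open piece of the cone inside a joint upper tail; its mass is
  positive, so joint and marginal tails have the same order.\<close>

lemma borel_measurable_vec_lambda:
  fixes f :: "'a \<Rightarrow> 'i::finite \<Rightarrow> real"
  assumes "\<And>i. (\<lambda>x. f x i) \<in> borel_measurable M"
  shows "(\<lambda>x. \<chi> i. f x i) \<in> borel_measurable M"
  using assms by (subst borel_measurable_euclidean_space) (auto simp: Basis_vec_def inner_axis)

lemma lower_orthant_borel [measurable, simp]:
  fixes w :: "'d::finite \<Rightarrow> real"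
  shows "{x :: real^'d. \<forall>i\<in>J. x $ i \<le> w i} \<in> sets borel"
  by measurable

lemma upper_orthant_borel [measurable, simp]:
  fixes w :: "'d::finite \<Rightarrow> real"
  shows "{x :: real^'d. \<exists>i\<in>J. w i < x $ i} \<in> sets borel"
  by measurable

lemma coord_max_measurable [measurable]:
  assumes "sets \<mu> = sets borel"
  shows "coord_max n \<in> PiM {..<n} (\<lambda>_. \<mu> :: (real^'d) measure) \<rightarrow>\<^sub>M borel"
proof -
  have [measurable]: "(\<lambda>y. y $ i) \<in> borel_measurable \<mu>" for i
    using measurable_cong_sets[OF assms refl] borel_measurable_nth by blast
  have *: "(\<lambda>x. MAX k\<in>{..<n}. x k $ i) \<in> borel_measurable (PiM {..<n} (\<lambda>_. \<mu>))" for i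
    by (rule borel_measurable_Max) auto
  show ?thesis
    unfolding coord_max_def by (rule borel_measurable_vec_lambda) (rule *)
qed

lemma scaled_max_measurable [measurable]:
  assumes [measurable_cong]: "sets \<mu> = sets borel"
  shows "(\<lambda>x. (1 / s) *\<^sub>R coord_max n x) \<in> PiM {..<n} (\<lambda>_. \<mu> :: (real^'d) measure) \<rightarrow>\<^sub>M borel"
  using coord_max_measurable[OF assms] by measurable

lemma prob_space_scaled_max_law:
  assumes "prob_space \<mu>" and s: "sets \<mu> = sets borel"
  shows "prob_space (scaled_max_law \<mu> n s)"
proof -
  interpret prob_space "PiM {..<n} (\<lambda>_. \<mu>)" by (rule prob_space_PiM) (rule assms)
  show ?thesis
    unfolding scaled_max_law_def by (rule prob_space_distr) (rule scaled_max_measurable[OF s])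
qed

lemma sets_scaled_max_law [simp]: "sets (scaled_max_law \<mu> n s) = sets borel"
  by (simp add: scaled_max_law_def)

text \<open>The maximum lies below a level iff every copy does, and independence turns this into an
  \<open>n\<close>-th power. The assumption \<open>0 < n\<close> keeps the maximum over a nonempty
  index set.\<close>

lemma measure_scaled_max_law:
  assumes "prob_space \<mu>" and s: "sets \<mu> = sets borel" and "0 < n" "0 < c"
  shows "measure (scaled_max_law \<mu> n c) {x. \<forall>i\<in>J. x $ i \<le> w i}
       = measure \<mu> {x. \<forall>i\<in>J. x $ i \<le> c * w i} ^ n"
proof -
  interpret \<mu>: prob_space \<mu> by fact
  interpret P: product_prob_space "\<lambda>_. \<mu>" "{..<n}" by standard
  have Max_le: "(MAX k\<in>{..<n}. x k $ i) \<le> y \<longleftrightarrow> (\<forall>k\<in>{..<n}. x k $ i \<le> y)"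
    for x :: "nat \<Rightarrow> real^'d" and i y
    using \<open>0 < n\<close> by (subst Max_le_iff) auto
  have "measure (scaled_max_law \<mu> n c) {x. \<forall>i\<in>J. x $ i \<le> w i}
      = measure (PiM {..<n} (\<lambda>_. \<mu>))
         {x \<in> space (PiM {..<n} (\<lambda>_. \<mu>)). \<forall>k\<in>{..<n}. x k \<in> {x. \<forall>i\<in>J. x $ i \<le> c * w i}}"
    unfolding scaled_max_law_def
    apply (subst measure_distr)
      apply (rule scaled_max_measurable[OF s])
     apply simp
    apply (rule arg_cong[where f="measure _"])
    using assms(3,4) by (auto simp: coord_max_def divide_le_eq mult.commute Max_le)
  also have "\<dots> = (\<Prod>k\<in>{..<n}. measure \<mu> {x. \<forall>i\<in>J. x $ i \<le> c * w i})"
    unfolding measure_def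
    by (subst P.emeasure_PiM_Collect)
      (auto simp: s \<mu>.emeasure_eq_measure ennreal_power)
  finally show ?thesis by simp
qed

lemma exp_series_ennreal:
  assumes "0 \<le> x" 
  shows "(\<Sum>n. ennreal (x ^ n / fact n)) = ennreal (exp x)"
proof -
  have s: "(\<lambda>n. x ^ n / fact n) sums exp x"
    using exp_converges[of x] by (simp add: divide_inverse mult.commute)
  show ?thesis
    using assms sums_unique[OF s] by (subst suminf_ennreal2) (auto intro: sums_summable[OF s])
qed

text \<open>Take a Poisson number, with mean the total mass \<open>m\<close>, of independent points
  with law \<open>\<mu> / m\<close>. If \<open>q\<close> is the chance that one point lies below
  \<open>w\<close>, the generating function of the Poisson law gives
  \<open>exp (- (m - m * q))\<close>, and \<open>m - m * q\<close> is the mass not below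
  \<open>w\<close>.\<close>

lemma poisson_maximum_exists:
  fixes \<mu> :: "(real^'d) measure"
  assumes "finite_measure \<mu>" and s: "sets \<mu> = sets borel"
  shows "\<exists>Q. prob_space Q \<and> sets Q = sets borel \<and>
    (\<forall>J w. (\<forall>i\<in>J. 0 \<le> w i) \<longrightarrow>
       measure Q {x. \<forall>i\<in>J. x $ i \<le> w i} = exp (- measure \<mu> {x. \<exists>i\<in>J. w i < x $ i}))"
proof -
  interpret \<mu>: finite_measure \<mu> by fact
  have sp: "space \<mu> = UNIV" using sets_eq_imp_space_eq[OF s] by simp
  define m where "m = measure \<mu> UNIV"
  show ?thesis
  proof (cases "m = 0")
    case True
    have z: "measure \<mu> A = 0" for A
      using True \<mu>.bounded_measure[of A] by (simp add: m_def sp order_antisym)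
    show ?thesis
      by (rule exI[of _ "return borel 0"]) (auto simp: z prob_space_return measure_return)
  next
    case False
    then have m: "0 < m" by (simp add: m_def zero_less_measure_iff)
    define p where "p = density \<mu> (\<lambda>_. ennreal (1 / m))"
    have sets_p: "sets p = sets borel" by (simp add: p_def s)
    have ep: "emeasure p A = ennreal (measure \<mu> A / m)" if "A \<in> sets borel" for A
      using m that unfolding p_def
      by (simp add: emeasure_density_const s \<mu>.emeasure_eq_measure flip: ennreal_mult)
    have pp: "prob_space p"
      proof (rule prob_spaceI)
      have "space p = UNIV" by (simp add: p_def sp)
      then show "emeasure p (space p) = 1" using ep[of UNIV] m by (simp add: m_def)
    qed
    \<comment> \<open>The empty sample gets the value \<open>0\<close>. Since the thresholds are
      nonnegative, it lies below them with probability \<open>1 = q ^ 0\<close>, so the formula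
      \<open>q ^ n\<close> also covers \<open>n = 0\<close>.\<close>
    define K where "K n = (if n = 0 then return borel 0 else scaled_max_law p n 1)" for n :: nat
    have pK: "prob_space (K n)" and sK: "sets (K n) = sets borel" for n
      by (auto simp: K_def prob_space_return intro!: prob_space_scaled_max_law pp sets_p)
    define Q where "Q = measure_pmf (poisson_pmf m) \<bind> K"
    have PA: "measure_pmf (poisson_pmf m) \<in> space (prob_algebra (count_space UNIV))"
      by (auto simp: space_prob_algebra prob_space_measure_pmf)
    have Km: "K \<in> count_space UNIV \<rightarrow>\<^sub>M prob_algebra borel"
      by (auto simp: space_prob_algebra pK sK)
    have pQ: "prob_space Q"
      unfolding Q_def by (rule prob_space_bind'[OF PA Km])
    have sQ: "sets Q = sets borel"
      unfolding Q_def by (rule sets_bind'[OF PA Km])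
    have "measure Q {x. \<forall>i\<in>J. x $ i \<le> w i} = exp (- measure \<mu> {x. \<exists>i\<in>J. w i < x $ i})"
      if w: "\<forall>i\<in>J. 0 \<le> w i" for J w
    proof -
      let ?L = "{x :: real^'d. \<forall>i\<in>J. x $ i \<le> w i}"
      let ?U = "{x :: real^'d. \<exists>i\<in>J. w i < x $ i}"
      define q where "q = measure p ?L"
      have q0: "0 \<le> q" by (simp add: q_def)
      have eK: "emeasure (K n) ?L = ennreal (q ^ n)" for n
      proof (cases "n = 0")
        case True then show ?thesis using w by (simp add: K_def)
      next
        case False
        interpret K: prob_space "K n" by (rule pK)
        show ?thesis
          unfolding K.emeasure_eq_measure
          using False measure_scaled_max_law[OF pp sets_p, of n 1 J w] by (simp add: K_def q_def)
      qed
      have "emeasure Q ?L = (\<integral>\<^sup>+n. ennreal (q ^ n) \<partial>measure_pmf (poisson_pmf m))"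
        unfolding Q_def by (subst emeasure_bind_prob_algebra[OF PA Km]) (simp_all add: eK)
      also have "\<dots> = (\<Sum>n. ennreal (exp (-m)) * ennreal ((m * q) ^ n / fact n))"
        unfolding nn_integral_measure_pmf nn_integral_count_space_nat
      proof (rule suminf_cong)
        fix n
        have "pmf (poisson_pmf m) n * q ^ n = exp (-m) * ((m * q) ^ n / fact n)"
          using m by (simp add: power_mult_distrib)
        then show "ennreal (pmf (poisson_pmf m) n) * ennreal (q ^ n)
          = ennreal (exp (-m)) * ennreal ((m * q) ^ n / fact n)"
          using m q0 by (metis ennreal_mult' pmf_nonneg exp_ge_zero)
      qed
      also have "\<dots> = ennreal (exp (-m)) * ennreal (exp (m * q))"
        using m q0 by (simp only: ennreal_suminf_cmult exp_series_ennreal[OF mult_nonneg_nonneg] less_imp_le)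
      also have "\<dots> = ennreal (exp (- (m - m * q)))"
        by (simp flip: ennreal_mult exp_add)
      also have "m - m * q = measure \<mu> ?U"
      proof -
        have "?U = space \<mu> - ?L" by (auto simp: sp not_le)
        then have "measure \<mu> ?U = m - measure \<mu> ?L"
          using \<mu>.finite_measure_compl[of ?L] by (simp add: s m_def sp)
        moreover have "m * q = measure \<mu> ?L"
          using m by (simp add: q_def measure_def[of p] ep)
        ultimately show ?thesis by simp
      qed
      finally show ?thesis by (simp add: measure_def)
    qed
    then show ?thesis using pQ sQ by blast
  qed
qed

text \<open>The measure may be infinite near the negative orthant, so the space is cut into countably many
  shells of finite mass, with independent Poisson samples on them. All shells but the first lie below
  \<open>1\<close>, which keeps the supremum finite.\<close>

lemma poisson_supremum_exists:
  fixes \<rho> :: "(real^'d) measure"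
  assumes s: "sets \<rho> = sets borel"
    and fin: "\<And>\<epsilon>. 0 < \<epsilon> \<Longrightarrow> emeasure \<rho> {x. \<exists>i. \<epsilon> < x $ i} < \<infinity>"
  shows "\<exists>\<nu>. prob_space \<nu> \<and> sets \<nu> = sets borel \<and>
    (\<forall>J w. (\<forall>i\<in>J. 0 < w i) \<longrightarrow>
       measure \<nu> {x. \<forall>i\<in>J. x $ i \<le> w i} = exp (- measure \<rho> {x. \<exists>i\<in>J. w i < x $ i}))"
proof -
  have sp: "space \<rho> = UNIV" using sets_eq_imp_space_eq[OF s] by simp
  \<comment> \<open>The shell \<open>B k\<close> consists of the points of \<open>E k\<close>
    outside all earlier \<open>E l\<close>. Points without a positive coordinate lie in no shell;
    they never exceed a positive threshold.\<close>
  define E where "E k = {x :: real^'d. \<exists>i\<in>UNIV. 1 / real (Suc k) < x $ i}" for k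
  define B where "B = disjointed E"
  define \<mu> where "\<mu> k = density \<rho> (indicator (B k))" for k
  have sE: "E k \<in> sets borel" for k unfolding E_def by (rule upper_orthant_borel)
  have sB: "B k \<in> sets borel" for k
    using sets.range_disjointed_sets[of E borel] sE by (auto simp: B_def)
  have BE: "B k \<subseteq> E k" for k by (simp add: B_def disjointed_subset)
  have e\<mu>: "emeasure (\<mu> k) A = emeasure \<rho> (B k \<inter> A)" if "A \<in> sets borel" for k A
    using that sB[of k] unfolding \<mu>_def
    by (subst emeasure_density) (auto simp: s indicator_inter_arith[symmetric] measurable_cong_sets[OF s refl])
  have m\<mu>: "measure (\<mu> k) A = measure \<rho> (B k \<inter> A)" if "A \<in> sets borel" for k A
    using e\<mu>[OF that] by (simp add: measure_def)
  have f\<mu>: "finite_measure (\<mu> k)" for k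
  proof (rule finite_measureI)
    have "emeasure \<rho> (B k) \<le> emeasure \<rho> (E k)"
      by (rule emeasure_mono[OF BE]) (simp add: s sE)
    also have "\<dots> < \<infinity>" unfolding E_def using fin[of "1 / real (Suc k)"] by simp
    finally show "emeasure (\<mu> k) (space (\<mu> k)) \<noteq> \<infinity>"
      using e\<mu>[of UNIV k] by (simp add: \<mu>_def sp)
  qed
  have s\<mu>: "sets (\<mu> k) = sets borel" for k by (simp add: \<mu>_def s)
  define good where "good k Q \<longleftrightarrow> prob_space Q \<and> sets Q = sets borel \<and>
    (\<forall>J w. (\<forall>i\<in>J. 0 \<le> w i) \<longrightarrow>
       measure Q {x. \<forall>i\<in>J. x $ i \<le> w i} = exp (- measure (\<mu> k) {x. \<exists>i\<in>J. w i < x $ i}))" for k Q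
  have "\<forall>k. \<exists>Q. good k Q"
    unfolding good_def using poisson_maximum_exists[OF f\<mu> s\<mu>] by blast
  from choice[OF this] obtain Q where good: "\<And>k. good k (Q k)" by auto
  have pQ: "prob_space (Q k)" and sQ: "sets (Q k) = sets borel" for k
    using good[of k] by (auto simp: good_def)
  have Q: "measure (Q k) {x. \<forall>i\<in>J. x $ i \<le> w i} = exp (- measure (\<mu> k) {x. \<exists>i\<in>J. w i < x $ i})"
    if "\<forall>i\<in>J. 0 \<le> w i" for k J w
    using good[of k] that by (auto simp: good_def)
  interpret P: product_prob_space Q "UNIV :: nat set"
    by (intro product_prob_spaceI pQ)
  let ?P = "PiM UNIV Q"
  have spQ: "space (Q k) = UNIV" for k using sets_eq_imp_space_eq[OF sQ] by simp
  have spP: "space ?P = UNIV" by (simp add: space_PiM spQ)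
  \<comment> \<open>The bound by \<open>1\<close> on the later samples holds only almost surely.
    Truncation makes the supremum finite at every point; almost surely it changes nothing.\<close>
  define V where "V k x i = (if k = 0 then x 0 $ i else min (x k $ i) 1)"
    for k :: nat and x :: "nat \<Rightarrow> real^'d" and i
  have mc: "(\<lambda>x. x k $ i) \<in> borel_measurable ?P" for k i
  proof -
    have "(\<lambda>y. y $ i) \<in> borel_measurable (Q k)"
      using measurable_cong_sets[OF sQ refl] borel_measurable_nth by blast
    then show ?thesis by (rule measurable_compose[OF measurable_component_singleton, rotated]) simp
  qed
  have mV: "(\<lambda>x. V k x i) \<in> borel_measurable ?P" for k i
    using mc unfolding V_def by measurable
  have bV: "bdd_above (range (\<lambda>k. V k x i))" for x i
    by (rule bdd_aboveI[of _ "max (x 0 $ i) 1"]) (auto simp: V_def)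
  define W where "W x = (\<chi> i. SUP k. V k x i)" for x
  have mW: "W \<in> borel_measurable ?P"
    unfolding W_def by (intro borel_measurable_vec_lambda borel_measurable_cSUP mV bV) auto
  have W_le: "W x $ i \<le> c \<longleftrightarrow> (\<forall>k. V k x i \<le> c)" for x i c
    unfolding W_def by (simp add: cSUP_le_iff[OF _ bV])
  have "AE x in ?P. \<forall>i\<in>UNIV. x k $ i \<le> 1" if "0 < k" for k
  proof -
    \<comment> \<open>For \<open>k > 0\<close> the shell is disjoint from \<open>E 0\<close>, the
      set of points with some coordinate above \<open>1\<close>.\<close>
    have "B k \<inter> {x. \<exists>i\<in>UNIV. 1 < x $ i} = {}"
      using that unfolding B_def disjointed_def by (force simp: E_def)
    then have "measure (Q k) {x. \<forall>i\<in>UNIV. x $ i \<le> 1} = 1"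
      using Q[of UNIV "\<lambda>_. 1" k] by (simp add: m\<mu>)
    then have "AE y in Q k. y \<in> {x. \<forall>i\<in>UNIV. x $ i \<le> 1}"
      by (rule P.M.AE_prob_1)
    then have "AE y in Q k. \<forall>i\<in>UNIV. y $ i \<le> 1" by simp
    then show ?thesis
      by (rule P.AE_component[OF UNIV_I])
  qed
  then have "\<forall>k. AE x in ?P. 0 < k \<longrightarrow> (\<forall>i\<in>UNIV. x k $ i \<le> 1)"
    by auto
  then have bdd: "AE x in ?P. \<forall>k. 0 < k \<longrightarrow> (\<forall>i\<in>UNIV. x k $ i \<le> 1)"
    by (subst AE_all_countable)
  have "measure (distr ?P borel W) {x. \<forall>i\<in>J. x $ i \<le> w i} = exp (- measure \<rho> {x. \<exists>i\<in>J. w i < x $ i})"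
    if w: "\<forall>i\<in>J. 0 < w i" for J w
  proof -
    let ?L = "{x :: real^'d. \<forall>i\<in>J. x $ i \<le> w i}"
    let ?U = "{x :: real^'d. \<exists>i\<in>J. w i < x $ i}"
    define S where "S n = {x \<in> space ?P. \<forall>k\<in>{..n}. x k \<in> ?L}" for n :: nat
    have mS: "S n \<in> sets ?P" for n
      unfolding S_def using mc by measurable
    have mW': "W -` ?L \<inter> space ?P \<in> sets ?P"
      by (rule measurable_sets[OF mW]) simp
    have "measure (distr ?P borel W) ?L = measure ?P (W -` ?L \<inter> space ?P)"
      by (subst measure_distr[OF mW]) auto
    also have "\<dots> = measure ?P (\<Inter>n. S n)"
    proof (rule measure_eq_AE[OF _ mW'])
      show "AE x in ?P. (x \<in> W -` ?L \<inter> space ?P) = (x \<in> (\<Inter>n. S n))"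
        using bdd
      proof eventually_elim
        case (elim x)
        have "V k x i = x k $ i" for k i
          using elim by (auto simp: V_def min_def)
        then show ?case
          by (auto simp: S_def spP W_le) (meson atMost_iff order_refl)
      qed
    qed (use mS in auto)
    finally have 1: "measure (distr ?P borel W) ?L = measure ?P (\<Inter>n. S n)" .
    have 2: "(\<lambda>n. measure ?P (S n)) \<longlonglongrightarrow> measure ?P (\<Inter>n. S n)"
      by (rule P.finite_Lim_measure_decseq) (use mS in \<open>auto simp: decseq_def S_def\<close>)
    have wle: "\<forall>i\<in>J. 0 \<le> w i" using w by (auto intro: less_imp_le)
    \<comment> \<open>Independence of the shells multiplies the exponentials, so the masses of the
      disjoint pieces of \<open>?U\<close> add up in the exponent; countable additivity then gives
      the limit.\<close>
    have 3: "measure ?P (S n) = exp (- (\<Sum>k\<le>n. measure \<rho> (B k \<inter> ?U)))" for n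
    proof -
      have "measure ?P (S n) = (\<Prod>k\<le>n. measure (Q k) ?L)"
        unfolding S_def measure_def
        by (subst P.emeasure_PiM_Collect)
          (auto simp: sQ P.M.emeasure_eq_measure prod_ennreal prod_nonneg)
      also have "\<dots> = (\<Prod>k\<le>n. exp (- measure \<rho> (B k \<inter> ?U)))"
        by (simp add: Q[OF wle] m\<mu>)
      finally show ?thesis by (simp add: exp_sum sum_negf[symmetric])
    qed
    \<comment> \<open>Inserting \<open>1\<close> keeps the minimum defined for empty
      \<open>J\<close>. Positivity of \<epsilon> places \<open>?U\<close> inside a single
      \<open>E N\<close>, hence makes its mass finite.\<close>
    define \<epsilon> where "\<epsilon> = Min (insert 1 (w ` J))"
    have fJ: "finite J" by simp
    have \<epsilon>: "0 < \<epsilon>" "\<And>i. i \<in> J \<Longrightarrow> \<epsilon> \<le> w i"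
      using w fJ by (auto simp: \<epsilon>_def)
    obtain N where N: "1 / real (Suc N) < \<epsilon>"
      using reals_Archimedean[OF \<epsilon>(1)] by (auto simp: inverse_eq_divide)
    have UE: "?U \<subseteq> E N"
    proof
      fix x :: "real^'d" assume "x \<in> ?U"
      then obtain i where "i \<in> J" "w i < x $ i" by auto
      then have "1 / real (Suc N) < x $ i" using \<epsilon>(2)[of i] N by linarith
      then show "x \<in> E N" unfolding E_def by blast
    qed
    have "(\<Union>k. B k) = (\<Union>k. E k)" unfolding B_def by (rule UN_disjointed_eq)
    then have UB: "(\<Union>k. B k \<inter> ?U) = ?U" using UE by blast
    have "emeasure \<rho> ?U \<le> emeasure \<rho> (E N)"
      by (rule emeasure_mono[OF UE]) (simp add: s sE)
    also have "\<dots> < \<infinity>" unfolding E_def using fin[of "1 / real (Suc N)"] by simp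
    finally have fU: "emeasure \<rho> ?U \<noteq> \<infinity>" by simp
    have "disjoint_family (\<lambda>k. B k \<inter> ?U)"
      using disjoint_family_disjointed[of E] by (auto simp: disjoint_family_on_def B_def)
    then have "(\<lambda>k. measure \<rho> (B k \<inter> ?U)) sums measure \<rho> ?U"
      using measure_UNION[of "\<lambda>k. B k \<inter> ?U" \<rho>] fU sB UB upper_orthant_borel[of J w]
      by (simp add: s image_subset_iff sets.Int)
    then have "(\<lambda>n. exp (- (\<Sum>k\<le>n. measure \<rho> (B k \<inter> ?U)))) \<longlonglongrightarrow> exp (- measure \<rho> ?U)"
      unfolding sums_def_le by (intro tendsto_intros)
    then show ?thesis
      using LIMSEQ_unique[OF 2] unfolding 1 3 by simp
  qed
  moreover have "prob_space (distr ?P borel W)"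
    by (rule P.prob_space_distr[OF mW])
  ultimately show ?thesis by (intro exI[of _ "distr ?P borel W"]) simp
qed

section \<open>Convergence in law from convergence of distribution functions\<close>

text \<open>Inclusion-exclusion, organised as an induction over the coordinates that carry a lower
  bound. All corners that arise have entries from \<open>a\<close> or \<open>b\<close>, hence are
  positive, where convergence is assumed.\<close>

lemma convergence_on_boxes:
  fixes \<mu> :: "nat \<Rightarrow> (real^'d) measure"
  assumes p: "\<And>n. prob_space (\<mu> n)" "prob_space \<nu>"
    and s: "\<And>n. sets (\<mu> n) = sets borel" "sets \<nu> = sets borel"
    and conv: "\<And>w. (\<And>i. 0 < w i) \<Longrightarrow>
      (\<lambda>n. measure (\<mu> n) {x. \<forall>i. x $ i \<le> w i}) \<longlonglongrightarrow> measure \<nu> {x. \<forall>i. x $ i \<le> w i}"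
    and ab: "\<And>i. 0 < a i" "\<And>i. a i \<le> b i"
  shows "(\<lambda>n. measure (\<mu> n) {x. \<forall>i. a i < x $ i \<and> x $ i \<le> b i})
    \<longlonglongrightarrow> measure \<nu> {x. \<forall>i. a i < x $ i \<and> x $ i \<le> b i}"
proof -
  have "(\<lambda>n. measure (\<mu> n) {x. (\<forall>i. x $ i \<le> b i) \<and> (\<forall>i\<in>J. a i < x $ i)})
    \<longlonglongrightarrow> measure \<nu> {x. (\<forall>i. x $ i \<le> b i) \<and> (\<forall>i\<in>J. a i < x $ i)}"
    if "finite J" "\<And>i. a i \<le> b i" for J b
    using that
  proof (induction J arbitrary: b)
    case empty
    show ?case using conv[of b] less_le_trans[OF ab(1) empty] by simp
  next
    case (insert j J)
    let ?H = "\<lambda>b J. {x :: real^'d. (\<forall>i. x $ i \<le> b i) \<and> (\<forall>i\<in>J. a i < x $ i)}"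
    \<comment> \<open>Imposing \<open>a j < x $ j\<close> removes the points with
      \<open>x $ j \<le> a j\<close>, that is, the same set with upper bound \<open>a j\<close> in
      place of \<open>b j\<close>. For this the induction must leave \<open>b\<close>
      arbitrary.\<close>
    have split: "measure m (?H b (insert j J)) = measure m (?H b J) - measure m (?H (b(j := a j)) J)"
      if m: "prob_space m" "sets m = sets borel" for m
    proof -
      interpret prob_space m by fact
      have H: "?H b J \<in> sets borel" for b J by measurable
      have *: "?H b (insert j J) = ?H b J - ?H (b(j := a j)) J" and "?H (b(j := a j)) J \<subseteq> ?H b J"
        using insert.hyps insert.prems by (auto simp: not_le split: if_splits)
          (metis order_trans)+
      then show ?thesis
        unfolding * using H by (intro finite_measure_Diff) (auto simp: m(2))
    qed
    show ?case
      unfolding split[OF p(1) s(1)] split[OF p(2) s(2)]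
      by (intro tendsto_diff insert.IH) (use insert.prems in auto)
  qed
  from this[of UNIV b] show ?thesis
    using ab by (simp add: conj_commute all_conj_distrib)
qed

lemma grid_index_exists:
  fixes \<delta> h x :: real
  assumes "0 < h" "\<delta> < x" "x \<le> \<delta> + real m * h"
  shows "\<exists>k<m. \<delta> + real k * h < x \<and> x \<le> \<delta> + real (Suc k) * h"
  using assms(3)
proof (induction m)
  case (Suc m)
  then show ?case
    by (cases "x \<le> \<delta> + real m * h") (auto simp: not_le intro: less_SucI)
qed (use assms in simp)

lemma grid_index_unique:
  fixes \<delta> h x :: real
  assumes "0 < h" "\<delta> + real k * h < x" "x \<le> \<delta> + real (Suc k) * h"
    "\<delta> + real l * h < x" "x \<le> \<delta> + real (Suc l) * h"
  shows "k = l"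
proof -
  have "real k * h < real (Suc l) * h" "real l * h < real (Suc k) * h" using assms by linarith+
  then have "real k < real (Suc l)" "real l < real (Suc k)" using assms(1) by simp_all
  then show ?thesis by simp
qed

text \<open>On a large half-open cube a continuous function is uniformly close to a combination of
  indicators of the cells of a fine grid, and cells are covered by \<open>convergence_on_boxes\<close>.\<close>

lemma converges_in_law_if_cdf_converges:
  fixes \<mu> :: "nat \<Rightarrow> (real^'d) measure"
  assumes p: "\<And>n. prob_space (\<mu> n)" "prob_space \<nu>"
    and s: "\<And>n. sets (\<mu> n) = sets borel" "sets \<nu> = sets borel"
    and conv: "\<And>w. (\<And>i. 0 < w i) \<Longrightarrow>
      (\<lambda>n. measure (\<mu> n) {x. \<forall>i. x $ i \<le> w i}) \<longlonglongrightarrow> measure \<nu> {x. \<forall>i. x $ i \<le> w i}"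
    and pos: "AE x in \<nu>. \<forall>i. 0 < x $ i"
  shows "converges_in_law \<mu> \<nu>"
  unfolding converges_in_law_def
proof (intro allI impI, elim conjE)
  fix g :: "real^'d \<Rightarrow> real"
  assume g: "continuous_on UNIV g" "bounded (range g)"
  obtain B where B: "0 < B" "\<And>x. \<bar>g x\<bar> \<le> B"
    using g(2) by (auto simp: bounded_pos)
  have gm: "g \<in> borel_measurable borel" using g(1) by (rule borel_measurable_continuous_onI)
  interpret \<nu>: prob_space \<nu> by fact
  show "(\<lambda>n. \<integral>x. g x \<partial>\<mu> n) \<longlonglongrightarrow> (\<integral>x. g x \<partial>\<nu>)"
  proof (rule LIMSEQ_I)
    fix r :: real assume r: "0 < r"
    \<comment> \<open>The final error is \<epsilon> for the cell sums and \<epsilon> + B \<epsilon>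
      for each of the two integrals, so below (4 + 4 B) \<epsilon> = r.\<close>
    define \<epsilon> where "\<epsilon> = r / (4 + 4 * B)"
    have \<epsilon>: "0 < \<epsilon>" using r B by (simp add: \<epsilon>_def)
    \<comment> \<open>These half-open cubes exhaust the open positive orthant, which carries all the
      mass of the limit by \<open>pos\<close>.\<close>
    define K where "K k = {x :: real^'d. \<forall>i. 1 / real (Suc k) < x $ i \<and> x $ i \<le> real (Suc k)}" for k :: nat
    have mK: "K k \<in> sets borel" for k unfolding K_def by measurable
    have "(\<lambda>k. measure \<nu> (K k)) \<longlonglongrightarrow> measure \<nu> (\<Union>k. K k)"
    proof (rule \<nu>.finite_Lim_measure_incseq)
      show "incseq K"
      proof (rule incseq_SucI, rule subsetI)
        fix k x assume x: "x \<in> K k"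
        have "1 / real (Suc (Suc k)) \<le> 1 / real (Suc k)" by (simp add: frac_le)
        moreover have "real (Suc k) \<le> real (Suc (Suc k))" by simp
        ultimately show "x \<in> K (Suc k)"
          using x unfolding K_def by (blast intro: le_less_trans order_trans)
      qed
    qed (use mK s in auto)
    moreover have "(\<Union>k. K k) = {x. \<forall>i. 0 < x $ i}"
    proof (intro set_eqI iffI)
      fix x :: "real^'d" assume x: "x \<in> {x. \<forall>i. 0 < x $ i}"
      have "\<forall>\<^sub>F k in sequentially. \<forall>i. 1 / real (Suc k) < x $ i \<and> x $ i \<le> real (Suc k)"
      proof (rule eventually_all_finite)
        fix i
        have "0 < x $ i" using x by simp
        then have "\<forall>\<^sub>F k in sequentially. 1 / real (Suc k) < x $ i"
          by (rule order_tendstoD(2)[OF LIMSEQ_inverse_real_of_nat[unfolded inverse_eq_divide]])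
        moreover have "\<forall>\<^sub>F k in sequentially. x $ i \<le> real (Suc k)"
          using eventually_ge_at_top[of "nat \<lceil>x $ i\<rceil>"] by eventually_elim linarith
        ultimately show "\<forall>\<^sub>F k in sequentially. 1 / real (Suc k) < x $ i \<and> x $ i \<le> real (Suc k)"
          by eventually_elim simp
      qed
      then show "x \<in> (\<Union>k. K k)" unfolding K_def by (auto simp: eventually_sequentially)
    next
      fix x assume "x \<in> (\<Union>k. K k)"
      then obtain k where k: "\<And>i. 1 / real (Suc k) < x $ i" by (auto simp: K_def)
      have "0 < 1 / real (Suc k)" by simp
      then show "x \<in> {x. \<forall>i. 0 < x $ i}" using k by (blast intro: less_trans)
    qed
    moreover have "measure \<nu> {x. \<forall>i. 0 < x $ i} = 1"
    proof -
      have [measurable]: "{x :: real^'d. \<forall>i. 0 < x $ i} \<in> sets \<nu>"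
        unfolding s by measurable
      show ?thesis
        using \<nu>.prob_Collect_eq_1[of "\<lambda>x. \<forall>i. 0 < x $ i"] pos sets_eq_imp_space_eq[OF s(2)] by simp
    qed
    ultimately have "(\<lambda>k. measure \<nu> (K k)) \<longlonglongrightarrow> 1" by simp
    then have "\<forall>\<^sub>F k in sequentially. 1 - \<epsilon> < measure \<nu> (K k)"
      by (rule order_tendstoD) (use \<epsilon> in simp)
    then obtain k where k: "1 - \<epsilon> < measure \<nu> (K k)" by (auto simp: eventually_sequentially)
    have inv_le: "1 / real (Suc k) \<le> real (Suc k)" by (rule order_trans[of _ 1]) auto
    define \<delta> b where "\<delta> = 1 / real (Suc k)" and "b = real (Suc k)"
    have \<delta>b: "0 < \<delta>" "\<delta> \<le> b" by (use inv_le in \<open>auto simp: \<delta>_def b_def\<close>)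
    have "uniformly_continuous_on (cbox (\<chi> i. \<delta>) (\<chi> i. b)) g"
      by (intro compact_uniformly_continuous continuous_on_subset[OF g(1)] compact_cbox) auto
    then obtain \<eta> where \<eta>: "0 < \<eta>"
      and uc: "\<And>x y. x \<in> cbox (\<chi> i. \<delta>) (\<chi> i. b) \<Longrightarrow> y \<in> cbox (\<chi> i. \<delta>) (\<chi> i. b) \<Longrightarrow> dist y x < \<eta> \<Longrightarrow> dist (g y) (g x) < \<epsilon>"
      unfolding uniformly_continuous_on_def using \<epsilon> by metis
    obtain m :: nat where m: "real CARD('d) * (b - \<delta> + 1) / \<eta> < real m"
      using reals_Archimedean2 by blast
    have "0 < real m"
      by (rule le_less_trans[OF _ m]) (use \<eta> \<delta>b in simp)
    \<comment> \<open>The extra \<open>1\<close> keeps the mesh positive when the cube is degenerate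
      (\<open>k = 0\<close>, where \<delta> = b). The grid then ends at \<open>b + 1\<close>, beyond
      the cube.\<close>
    define h where "h = (b - \<delta> + 1) / real m"
    have h: "0 < h" using \<delta>b \<open>0 < real m\<close> by (simp add: h_def)
    have h\<eta>: "real CARD('d) * h < \<eta>"
      using m \<eta> \<open>0 < real m\<close> by (simp add: h_def field_simps)
    have mh: "b \<le> \<delta> + real m * h" using \<open>0 < real m\<close> by (simp add: h_def)
    define C where "C = {c :: 'd \<Rightarrow> nat. \<forall>i. c i < m}"
    have "C = (\<Pi>\<^sub>E i\<in>UNIV. {..<m})" by (auto simp: C_def PiE_iff)
    then have finC: "finite C" by (simp add: finite_PiE)
    \<comment> \<open>The minimum with \<open>b\<close> cuts cells off at the face of the cube. The
      outer maximum makes cells starting beyond \<open>b\<close> empty while preserving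
      \<open>lo \<le> up\<close>, as required for convergence on boxes.\<close>
    define lo up where "lo c i = \<delta> + real (c i) * h" and "up c i = max (lo c i) (min b (\<delta> + real (Suc (c i)) * h))"
      for c :: "'d \<Rightarrow> nat" and i
    define bx where "bx c = {x :: real^'d. \<forall>i. lo c i < x $ i \<and> x $ i \<le> up c i}" for c
    have mbx: "bx c \<in> sets borel" for c unfolding bx_def by measurable
    have bxD: "\<delta> + real (c i) * h < x $ i \<and> x $ i \<le> \<delta> + real (Suc (c i)) * h \<and> x $ i \<le> b" if "x \<in> bx c" for x c i
      using that by (auto simp: bx_def lo_def up_def max_def min_def split: if_splits dest!: spec[of _ i])
    have bxK: "x \<in> K k" if "x \<in> bx c" for x c
    proof -
      have "\<delta> < x $ i \<and> x $ i \<le> b" for i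
        using bxD[OF that, of i] h by (smt (verit) mult_nonneg_nonneg of_nat_0_le_iff)
      then show ?thesis by (simp add: K_def \<delta>_def b_def)
    qed
    have bx_unique: "c = c'" if "x \<in> bx c" "x \<in> bx c'" for x c c'
    proof
      fix i show "c i = c' i"
        using grid_index_unique[OF h] bxD[OF that(1), of i] bxD[OF that(2), of i] by blast
    qed
    have bx_ex: "\<exists>c\<in>C. x \<in> bx c" if "x \<in> K k" for x
    proof -
      have xb: "\<delta> < x $ i \<and> x $ i \<le> b" for i using that by (simp add: K_def \<delta>_def b_def)
      have "\<forall>i. \<exists>l<m. \<delta> + real l * h < x $ i \<and> x $ i \<le> \<delta> + real (Suc l) * h"
        using grid_index_exists[OF h] xb mh by (meson order_trans)
      from choice[OF this] obtain c where
        "\<forall>i. c i < m \<and> \<delta> + real (c i) * h < x $ i \<and> x $ i \<le> \<delta> + real (Suc (c i)) * h" by auto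
      then have "c \<in> C" "x \<in> bx c"
        using xb by (auto simp: C_def bx_def lo_def up_def le_max_iff_disj)
      then show ?thesis by blast
    qed
    \<comment> \<open>For an empty cell the chosen point is arbitrary, but its term in the step
      function vanishes with the indicator.\<close>
    define pt where "pt c = (SOME x. x \<in> bx c)" for c
    have pt: "pt c \<in> bx c" if "x \<in> bx c" for x c
      using that unfolding pt_def by (rule someI)
    define \<phi> where "\<phi> x = (\<Sum>c\<in>C. g (pt c) * indicator (bx c) x)" for x
    have \<phi>0: "\<phi> x = 0" if "x \<notin> K k" for x
      unfolding \<phi>_def using bxK that by (intro sum.neutral) (auto simp: indicator_def)
    have \<phi>1: "\<phi> x = g (pt c)" if "c \<in> C" "x \<in> bx c" for x c
    proof -
      have "\<phi> x = (\<Sum>d\<in>C. if d = c then g (pt c) else 0)"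
        unfolding \<phi>_def by (rule sum.cong) (use that bx_unique in \<open>auto simp: indicator_def\<close>)
      then show ?thesis using finC that by simp
    qed
    have close: "\<bar>g x - \<phi> x\<bar> \<le> \<epsilon>" if xK: "x \<in> K k" for x
    proof -
      obtain c where c: "c \<in> C" "x \<in> bx c" using bx_ex[OF xK] by blast
      have box: "y \<in> cbox (\<chi> i. \<delta>) (\<chi> i. b)" if "y \<in> K k" for y
        using that by (auto simp: mem_box_cart K_def \<delta>_def b_def intro: less_imp_le)
      have "dist x (pt c) \<le> (\<Sum>i\<in>UNIV. \<bar>(x - pt c) $ i\<bar>)"
        unfolding dist_norm by (rule norm_le_l1_cart)
      also have "\<dots> \<le> (\<Sum>i\<in>(UNIV :: 'd set). h)"
      proof (rule sum_mono)
        fix i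
        show "\<bar>(x - pt c) $ i\<bar> \<le> h"
          using bxD[OF c(2), of i] bxD[OF pt[OF c(2)], of i] by (simp add: algebra_simps abs_le_iff)
      qed
      also have "\<dots> < \<eta>" using h\<eta> by simp
      finally have "dist (g x) (g (pt c)) < \<epsilon>"
        by (intro uc box xK bxK[OF pt[OF c(2)]])
      then show ?thesis using \<phi>1[OF c] by (simp add: dist_real_def)
    qed
    have int_bound: "\<bar>(\<integral>x. g x \<partial>M) - (\<Sum>c\<in>C. g (pt c) * measure M (bx c))\<bar> \<le> \<epsilon> + B * (1 - measure M (K k))"
      if M: "prob_space M" "sets M = sets borel" for M
    proof -
      interpret prob_space M by fact
      have spM: "space M = UNIV" using sets_eq_imp_space_eq[OF M(2)] by simp
      have gM: "g \<in> borel_measurable M" using gm measurable_cong_sets[OF M(2) refl] by blast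
      have ig: "integrable M g"
        by (rule integrable_const_bound[of _ B]) (use B gM in auto)
      have i\<phi>: "integrable M \<phi>"
        unfolding \<phi>_def using mbx M(2) by (auto intro!: integrable_sum integrable_mult_right integrable_real_indicator simp: emeasure_eq_measure)
      have "(\<integral>x. \<phi> x \<partial>M) = (\<Sum>c\<in>C. g (pt c) * measure M (bx c))"
        unfolding \<phi>_def using mbx M(2)
        by (subst Bochner_Integration.integral_sum)
          (auto intro!: integrable_mult_right integrable_real_indicator simp: emeasure_eq_measure spM)
      then have "\<bar>(\<integral>x. g x \<partial>M) - (\<Sum>c\<in>C. g (pt c) * measure M (bx c))\<bar> = \<bar>\<integral>x. g x - \<phi> x \<partial>M\<bar>"
        using ig i\<phi> by simp
      also have "\<dots> \<le> (\<integral>x. \<bar>g x - \<phi> x\<bar> \<partial>M)" by (rule integral_abs_bound)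
      also have "\<dots> \<le> (\<integral>x. \<epsilon> + B * indicator (- K k) x \<partial>M)"
      proof (rule integral_mono)
        fix x show "\<bar>g x - \<phi> x\<bar> \<le> \<epsilon> + B * indicator (- K k) x"
          using close[of x] \<phi>0[of x] B(2)[of x] \<epsilon> by (cases "x \<in> K k") auto
      qed (use ig i\<phi> mK M(2) in \<open>auto intro!: integrable_add integrable_mult_right integrable_real_indicator simp: emeasure_eq_measure borel_comp\<close>)
      also have "\<dots> = \<epsilon> + B * measure M (- K k)"
        using mK M(2) by (subst Bochner_Integration.integral_add) (auto intro!: integrable_mult_right integrable_real_indicator simp: emeasure_eq_measure borel_comp spM prob_space[unfolded spM])
      also have "measure M (- K k) = 1 - measure M (K k)"
        using prob_compl[of "K k"] mK M(2) by (simp add: spM Compl_eq_Diff_UNIV)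
      finally show ?thesis .
    qed
    have lim_bx: "(\<lambda>n. measure (\<mu> n) (bx c)) \<longlonglongrightarrow> measure \<nu> (bx c)" for c
      unfolding bx_def
    proof (rule convergence_on_boxes[OF p s conv])
      show "0 < lo c i" "lo c i \<le> up c i" for i
        using \<delta>b h by (auto simp: lo_def up_def add_pos_nonneg)
    qed
    \<comment> \<open>The cube is itself a box, so convergence of its mass replaces a separate
      tightness argument.\<close>
    have lim_K: "(\<lambda>n. measure (\<mu> n) (K k)) \<longlonglongrightarrow> measure \<nu> (K k)"
      unfolding K_def
      by (rule convergence_on_boxes[OF p s conv]) (use inv_le in auto)
    have "(\<lambda>n. \<Sum>c\<in>C. g (pt c) * measure (\<mu> n) (bx c)) \<longlonglongrightarrow> (\<Sum>c\<in>C. g (pt c) * measure \<nu> (bx c))"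
      by (intro tendsto_intros lim_bx)
    then have "\<forall>\<^sub>F n in sequentially. \<bar>(\<Sum>c\<in>C. g (pt c) * measure (\<mu> n) (bx c)) - (\<Sum>c\<in>C. g (pt c) * measure \<nu> (bx c))\<bar> < \<epsilon>"
      by (auto dest!: tendstoD[OF _ \<epsilon>] simp: dist_real_def)
    moreover have "\<forall>\<^sub>F n in sequentially. 1 - \<epsilon> < measure (\<mu> n) (K k)"
      using lim_K k by (rule order_tendstoD)
    ultimately have "\<forall>\<^sub>F n in sequentially. norm ((\<integral>x. g x \<partial>\<mu> n) - (\<integral>x. g x \<partial>\<nu>)) < r"
    proof eventually_elim
      case (elim n)
      have "\<bar>(\<integral>x. g x \<partial>\<mu> n) - (\<Sum>c\<in>C. g (pt c) * measure (\<mu> n) (bx c))\<bar> \<le> \<epsilon> + B * (1 - measure (\<mu> n) (K k))"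
        by (rule int_bound[OF p(1) s(1)])
      moreover have "B * (1 - measure (\<mu> n) (K k)) \<le> B * \<epsilon>"
        using B elim(2) by (intro mult_left_mono) auto
      moreover have "\<bar>(\<integral>x. g x \<partial>\<nu>) - (\<Sum>c\<in>C. g (pt c) * measure \<nu> (bx c))\<bar> \<le> \<epsilon> + B * (1 - measure \<nu> (K k))"
        by (rule int_bound[OF p(2) s(2)])
      moreover have "B * (1 - measure \<nu> (K k)) \<le> B * \<epsilon>"
        using B k by (intro mult_left_mono) auto
      ultimately have "\<bar>(\<integral>x. g x \<partial>\<mu> n) - (\<integral>x. g x \<partial>\<nu>)\<bar> < 3 * \<epsilon> + 2 * (B * \<epsilon>)"
        using elim(1) by linarith
      also have "\<dots> \<le> (4 + 4 * B) * \<epsilon>" using B \<epsilon> by (simp add: algebra_simps)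
      also have "\<dots> = r" using B by (simp add: \<epsilon>_def)
      finally show ?case by simp
    qed
    then show "\<exists>no. \<forall>n\<ge>no. norm ((\<integral>x. g x \<partial>\<mu> n) - (\<integral>x. g x \<partial>\<nu>)) < r"
      by (simp add: eventually_sequentially)
  qed
qed

text \<open>Taking logarithms, the error \<open>n * (ln (1 - p n) + p n)\<close> is at most
  \<open>2 * n * (p n)\<^sup>2\<close>, which is \<open>2 * (n * p n) * p n\<close> and tends to
  \<open>0\<close> because \<open>p n\<close> does.\<close>

lemma power_one_minus_tendsto:
  fixes p :: "nat \<Rightarrow> real"
  assumes np: "(\<lambda>n. real n * p n) \<longlonglongrightarrow> a"
  shows "(\<lambda>n. (1 - p n) ^ n) \<longlonglongrightarrow> exp (- a)"
proof -
  have "(\<lambda>n. real n * p n * (1 / real n)) \<longlonglongrightarrow> a * 0"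
    by (intro tendsto_mult np lim_1_over_n)
  then have "(\<lambda>n. real n * p n * (1 / real n)) \<longlonglongrightarrow> 0" by simp
  then have p0: "p \<longlonglongrightarrow> 0"
  proof (rule Lim_transform_eventually)
    show "\<forall>\<^sub>F n in sequentially. real n * p n * (1 / real n) = p n"
      using eventually_gt_at_top[of 0] by eventually_elim simp
  qed
  have small: "\<forall>\<^sub>F n in sequentially. \<bar>p n\<bar> < 1 / 2"
    using tendstoD[OF p0, of "1/2"] by simp
  have "(\<lambda>n. real n * ln (1 - p n) + real n * p n) \<longlonglongrightarrow> 0"
  proof (rule Lim_null_comparison)
    show "\<forall>\<^sub>F n in sequentially. norm (real n * ln (1 - p n) + real n * p n) \<le> 2 * \<bar>real n * p n\<bar> * \<bar>p n\<bar>"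
      using small
    proof eventually_elim
      case (elim n)
      have "\<bar>ln (1 + - p n) - - p n\<bar> \<le> 2 * (- p n)\<^sup>2"
        by (rule abs_ln_one_plus_x_minus_x_bound) (use elim in simp)
      then have "real n * \<bar>ln (1 - p n) + p n\<bar> \<le> real n * (2 * (p n)\<^sup>2)"
        by (intro mult_left_mono) auto
      moreover have "(p n)\<^sup>2 = \<bar>p n\<bar> * \<bar>p n\<bar>" by (simp add: power2_eq_square)
      ultimately have "real n * \<bar>ln (1 - p n) + p n\<bar> \<le> 2 * \<bar>real n * p n\<bar> * \<bar>p n\<bar>"
        by (simp only: abs_mult abs_of_nat mult.assoc mult.left_commute[of 2])
      then show ?case
        by (simp only: distrib_left[symmetric] real_norm_def abs_mult abs_of_nat)
    qed
    have "(\<lambda>n. 2 * \<bar>real n * p n\<bar> * \<bar>p n\<bar>) \<longlonglongrightarrow> 2 * \<bar>a\<bar> * \<bar>0\<bar>"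
      by (intro tendsto_intros np p0)
    then show "(\<lambda>n. 2 * \<bar>real n * p n\<bar> * \<bar>p n\<bar>) \<longlonglongrightarrow> 0" by simp
  qed
  then have "(\<lambda>n. exp ((real n * ln (1 - p n) + real n * p n) - real n * p n)) \<longlonglongrightarrow> exp (0 - a)"
    by (intro tendsto_intros np)
  then have "(\<lambda>n. exp (real n * ln (1 - p n))) \<longlonglongrightarrow> exp (- a)" by simp
  then show ?thesis
  proof (rule Lim_transform_eventually)
    show "\<forall>\<^sub>F n in sequentially. exp (real n * ln (1 - p n)) = (1 - p n) ^ n"
      using small by eventually_elim (simp add: exp_of_nat_mult)
  qed
qed

section \<open>Regularly varying densities on a cone\<close>

lemma nn_integral_lborel_scale:
  fixes g :: "'a::euclidean_space \<Rightarrow> ennreal"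
  assumes [measurable]: "g \<in> borel_measurable borel" and t: "0 < t"
  shows "(\<integral>\<^sup>+x. g x \<partial>lborel) = ennreal (t ^ DIM('a)) * (\<integral>\<^sup>+x. g (t *\<^sub>R x) \<partial>lborel)"
proof -
  have "(\<integral>\<^sup>+x. g x \<partial>lborel)
      = (\<integral>\<^sup>+x. g x \<partial>density (distr lborel borel (\<lambda>x. 0 + t *\<^sub>R x)) (\<lambda>_. ennreal (\<bar>t\<bar> ^ DIM('a))))"
    using lborel_affine[of t "0::'a"] t by simp
  also have "\<dots> = ennreal (t ^ DIM('a)) * (\<integral>\<^sup>+x. g (t *\<^sub>R x) \<partial>lborel)"
    using t by (simp add: nn_integral_density nn_integral_distr nn_integral_cmult)
  finally show ?thesis .
qed

lemma emeasure_density_dilate: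
  fixes g :: "'a::euclidean_space \<Rightarrow> ennreal"
  assumes [measurable]: "g \<in> borel_measurable borel" "A \<in> sets borel" and t: "0 < t"
  shows "emeasure (density lborel g) {x. (1 / t) *\<^sub>R x \<in> A}
       = ennreal (t ^ DIM('a)) * (\<integral>\<^sup>+x. g (t *\<^sub>R x) * indicator A x \<partial>lborel)"
proof -
  have "emeasure (density lborel g) {x. (1 / t) *\<^sub>R x \<in> A}
      = (\<integral>\<^sup>+x. g x * indicator A ((1 / t) *\<^sub>R x) \<partial>lborel)"
    by (subst emeasure_density) (auto intro!: nn_integral_cong simp: indicator_def)
  also have "\<dots> = ennreal (t ^ DIM('a)) * (\<integral>\<^sup>+x. g (t *\<^sub>R x) * indicator A ((1 / t) *\<^sub>R t *\<^sub>R x) \<partial>lborel)"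
    by (rule nn_integral_lborel_scale[OF _ t]) measurable
  finally show ?thesis using t by simp
qed

lemma dyadic_scale_exists:
  fixes \<epsilon> x :: real
  assumes "0 < \<epsilon>" "\<epsilon> \<le> x"
  shows "\<exists>k. 2 ^ k * \<epsilon> \<le> x \<and> x < 2 ^ Suc k * \<epsilon>"
proof -
  obtain n where n: "x / \<epsilon> < 2 ^ n" using real_arch_pow[of 2 "x / \<epsilon>"] by auto
  then have ex: "x < 2 ^ n * \<epsilon>" using assms by (simp add: divide_less_eq)
  define m where "m = (LEAST n. x < 2 ^ n * \<epsilon>)"
  have m: "x < 2 ^ m * \<epsilon>" unfolding m_def using ex by (rule LeastI)
  then have "m \<noteq> 0" using assms by (intro notI) simp
  then obtain k where k: "m = Suc k" by (cases m) auto
  then have "\<not> x < 2 ^ k * \<epsilon>" using not_less_Least[of k "\<lambda>n. x < 2 ^ n * \<epsilon>"] by (simp add: m_def)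
  then show ?thesis using m k by (intro exI[of _ k]) (simp add: not_less)
qed

text \<open>The dyadic sum plays the role of \<open>\<parallel>y\<parallel> powr - (d + \<delta>)\<close> away from the origin; in this form both
  its integrability and Potter's bound follow from the geometric series alone.\<close>

definition dyadic_majorant :: "real \<Rightarrow> real \<Rightarrow> 'a::euclidean_space \<Rightarrow> real" where
  "dyadic_majorant q \<epsilon> y = (\<Sum>k. q ^ k * indicator (ball 0 (2 ^ Suc k * \<epsilon>)) y)"

lemma dyadic_majorant_summable:
  assumes "0 < q" "q < 1"
  shows "summable (\<lambda>k. q ^ k * indicator (ball 0 (2 ^ Suc k * \<epsilon>)) (y :: 'a::euclidean_space) :: real)"
proof (rule summable_comparison_test')
  show "summable (\<lambda>k. q ^ k)" using assms by (intro summable_geometric) simp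
  show "norm (q ^ k * indicator (ball 0 (2 ^ Suc k * \<epsilon>)) y) \<le> q ^ k" if "0 \<le> k" for k
    using assms by (auto simp: indicator_def)
qed

lemma dyadic_majorant_ge:
  assumes "0 < q" "q < 1" "norm (y :: 'a::euclidean_space) < 2 ^ Suc k * \<epsilon>"
  shows "q ^ k \<le> dyadic_majorant q \<epsilon> y"
proof -
  have "(\<Sum>k\<in>{k}. q ^ k * indicator (ball 0 (2 ^ Suc k * \<epsilon>)) y) \<le> dyadic_majorant q \<epsilon> y"
    unfolding dyadic_majorant_def
    by (rule sum_le_suminf[OF dyadic_majorant_summable]) (use assms in auto)
  then show ?thesis using assms(3) by (simp add: indicator_def)
qed

text \<open>The volume of the \<open>k\<close>-th ball is a constant times
  \<open>2 ^ DIM('a)\<close> to the power \<open>k\<close>, so the condition on \<open>q\<close>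
  says that the geometric series of integrals converges.\<close>

lemma dyadic_majorant_integrable:
  assumes q: "0 < q" "q * 2 ^ DIM('a) < 1" and \<epsilon>: "0 < \<epsilon>"
  shows "integrable lborel (dyadic_majorant q \<epsilon> :: 'a::euclidean_space \<Rightarrow> real)"
  unfolding dyadic_majorant_def
proof (rule integrable_suminf)
  let ?B = "\<lambda>k. ball (0::'a) (2 ^ Suc k * \<epsilon>)"
  have "q * 1 \<le> q * 2 ^ DIM('a)" using q by (intro mult_left_mono) auto
  then have q1: "q < 1" using q(2) by linarith
  show int: "integrable lborel (\<lambda>y. q ^ k * indicator (?B k) y :: real)" for k
    by (intro integrable_mult_right integrable_real_indicator emeasure_lborel_ball_finite) simp
  show "AE y in lborel. summable (\<lambda>k. norm (q ^ k * indicator (?B k) y :: real))"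
  proof (rule AE_I2)
    fix y :: 'a
    have "norm (q ^ k * indicator (?B k) y :: real) = q ^ k * indicator (?B k) y" for k
      using q(1) by (auto simp: indicator_def)
    then show "summable (\<lambda>k. norm (q ^ k * indicator (?B k) y :: real))"
      using dyadic_majorant_summable[OF q(1) q1] by (simp only:)
  qed
  have "(\<integral>y. norm (q ^ k * indicator (?B k) y :: real) \<partial>lborel)
      = (unit_ball_vol (real DIM('a)) * (2 * \<epsilon>) ^ DIM('a)) * (q * 2 ^ DIM('a)) ^ k" for k
  proof -
    have "(\<integral>y. norm (q ^ k * indicator (?B k) y :: real) \<partial>lborel) = q ^ k * measure lborel (?B k)"
      using q by (simp add: abs_mult emeasure_lborel_ball_finite)
    also have "measure lborel (?B k) = unit_ball_vol (real DIM('a)) * (2 ^ Suc k * \<epsilon>) ^ DIM('a)"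
      using \<epsilon> content_ball[of "2 ^ Suc k * \<epsilon>" "0::'a"] by simp
    finally show ?thesis by (simp add: power_mult_distrib mult_ac flip: power_mult)
  qed
  moreover have "summable (\<lambda>k. (q * 2 ^ DIM('a)) ^ k)"
    using q by (intro summable_geometric) simp
  ultimately show "summable (\<lambda>k. \<integral>y. norm (q ^ k * indicator (?B k) y :: real) \<partial>lborel)"
    by (simp add: summable_mult)
qed

lemma Inf_scale:
  fixes S :: "real set"
  assumes "S \<noteq> {}" "bdd_below S" "0 < t"
  shows "Inf ((\<lambda>s. t * s) ` S) = t * Inf S"
proof (rule continuous_at_Inf_mono[symmetric])
  show "mono ((*) t)" using assms by (intro monoI mult_left_mono) auto
qed (use assms in \<open>auto intro!: continuous_intros\<close>)

section \<open>The cone, its gauge and the homogeneous measure\<close>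

locale gauge_setting =
  fixes D :: "(real^'d) set" and lam :: real
  assumes D: "D \<in> shape_class" and lam: "0 < lam"
begin

definition intensity :: "real^'d \<Rightarrow> real" where
  "intensity x = (if x \<in> cone_of D then 1 / gauge_fun D x powr (lam + real CARD('d)) else 0)"

text \<open>This is \<open>gauge_measure\<close> for \<open>c = 1\<close> without the origin cut
  out: the origin is a null set, and on the whole space the dilation formulas for Lebesgue measure
  apply directly.\<close>

definition rho :: "(real^'d) measure" where
  "rho = density lborel (\<lambda>x. ennreal (intensity x))"

lemma intensity_nonneg: "0 \<le> intensity x"
  by (simp add: intensity_def)

lemma D_star: "x \<in> D \<Longrightarrow> 0 < s \<Longrightarrow> s \<le> 1 \<Longrightarrow> s *\<^sub>R x \<in> D"
  using D by (cases "s = 1") (auto simp: shape_class_def star_shaped_def)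

text \<open>Star-shapedness allows shrinking, so the integer multiples in \<open>cone_of\<close> can
  be replaced by arbitrary positive factors; invariance of the cone under positive scaling then
  becomes immediate.\<close>

lemma mem_cone_iff: "x \<in> cone_of D \<longleftrightarrow> (\<exists>s>0. s *\<^sub>R x \<in> D)"
proof
  assume "x \<in> cone_of D"
  then obtain n :: nat and y where "0 < n" "y \<in> D" "x = real n *\<^sub>R y"
    by (auto simp: cone_of_def)
  then show "\<exists>s>0. s *\<^sub>R x \<in> D" by (intro exI[of _ "1 / real n"]) auto
next
  assume "\<exists>s>0. s *\<^sub>R x \<in> D"
  then obtain s where s: "0 < s" "s *\<^sub>R x \<in> D" by auto
  obtain n :: nat where n: "1 / s < real n" using reals_Archimedean2 by blast
  then have n0: "0 < real n" using s(1) by (meson less_trans zero_less_divide_1_iff)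
  have "1 / (real n * s) \<le> 1" using n s n0 by (simp add: field_simps)
  then have "(1 / (real n * s)) *\<^sub>R s *\<^sub>R x \<in> D"
    using s n0 by - (rule D_star[OF s(2)], auto)
  then have "(1 / real n) *\<^sub>R x \<in> D" using s by simp
  then have "x \<in> (\<lambda>x. real n *\<^sub>R x) ` D"
    using n0 by (intro image_eqI[of _ _ "(1 / real n) *\<^sub>R x"]) auto
  then show "x \<in> cone_of D" using n0 by (auto simp: cone_of_def)
qed

lemma cone_scale: "0 < t \<Longrightarrow> t *\<^sub>R x \<in> cone_of D \<longleftrightarrow> x \<in> cone_of D"
proof -
  have *: "t *\<^sub>R x \<in> cone_of D" if x: "x \<in> cone_of D" and "0 < t" for t x
  proof -
    obtain s where "0 < s" "s *\<^sub>R x \<in> D" using x mem_cone_iff[of x] by auto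
    then show ?thesis
      unfolding mem_cone_iff using that by (intro exI[of _ "s / t"]) auto
  qed
  assume t: "0 < t"
  show ?thesis
    using *[of x t] *[of "t *\<^sub>R x" "1 / t"] t by auto
qed

lemma open_cone: "open (cone_of D)"
proof -
  have "open ((\<lambda>x. real n *\<^sub>R x) ` D)" if "0 < n" for n
    using that D by (intro open_scaling) (auto simp: shape_class_def)
  then show ?thesis unfolding cone_of_def by (intro open_UN) auto
qed

lemma gauge_set_conv:
  "{t. 0 < t \<and> x \<in> (\<lambda>y. t *\<^sub>R y) ` D} = {t. 0 < t \<and> (1 / t) *\<^sub>R x \<in> D}"
  by (auto intro!: image_eqI[of _ _ "(1 / t) *\<^sub>R x" for t])

lemma gauge_set_nonempty: "x \<in> cone_of D \<Longrightarrow> {t. 0 < t \<and> (1 / t) *\<^sub>R x \<in> D} \<noteq> {}"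
proof -
  assume "x \<in> cone_of D"
  then obtain s where "0 < s" "s *\<^sub>R x \<in> D" using mem_cone_iff[of x] by auto
  then have "1 / s \<in> {t. 0 < t \<and> (1 / t) *\<^sub>R x \<in> D}" by simp
  then show ?thesis by blast
qed

lemma gauge_scale:
  assumes "x \<in> cone_of D" "0 < t"
  shows "gauge_fun D (t *\<^sub>R x) = t * gauge_fun D x"
proof -
  have "{s. 0 < s \<and> (1 / s) *\<^sub>R t *\<^sub>R x \<in> D} = (\<lambda>s. t * s) ` {s. 0 < s \<and> (1 / s) *\<^sub>R x \<in> D}"
    using assms(2) by (auto intro!: image_eqI[of _ _ "s / t" for s])
  moreover have "bdd_below {s. 0 < s \<and> (1 / s) *\<^sub>R x \<in> D}" by (rule bdd_belowI[of _ 0]) auto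
  ultimately show ?thesis
    unfolding gauge_fun_def gauge_set_conv
    using Inf_scale[OF gauge_set_nonempty[OF assms(1)] _ assms(2)] by simp
qed

text \<open>If \<open>D\<close> lies in the ball of radius \<open>R\<close>, then a point of
  \<open>t D\<close> has norm at most \<open>t * R\<close>. This is the only use of boundedness; it
  gives positivity of the gauge off the origin and the decay needed for the majorant.\<close>

lemma gauge_lower_bound: "\<exists>R>0. \<forall>x\<in>cone_of D. norm x / R \<le> gauge_fun D x"
proof -
  obtain R where R: "0 < R" "\<And>x. x \<in> D \<Longrightarrow> norm x \<le> R"
    using D by (auto simp: shape_class_def bounded_pos)
  have "norm x / R \<le> gauge_fun D x" if x: "x \<in> cone_of D" for x
    unfolding gauge_fun_def gauge_set_conv
  proof (rule cInf_greatest[OF gauge_set_nonempty[OF x]])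
    fix t assume "t \<in> {t. 0 < t \<and> (1 / t) *\<^sub>R x \<in> D}"
    then have t: "0 < t" "norm ((1 / t) *\<^sub>R x) \<le> R" using R(2) by blast+
    then show "norm x / R \<le> t" using R(1) by (simp add: field_simps)
  qed
  then show ?thesis using R(1) by blast
qed

lemma gauge_pos: "x \<in> cone_of D \<Longrightarrow> x \<noteq> 0 \<Longrightarrow> 0 < gauge_fun D x"
  using gauge_lower_bound by (meson divide_pos_pos less_le_trans zero_less_norm_iff)

lemma gauge_nonneg: "x \<in> cone_of D \<Longrightarrow> 0 \<le> gauge_fun D x"
  using gauge_lower_bound by (meson divide_nonneg_pos order_trans norm_ge_zero)

lemma intensity_measurable [measurable]: "intensity \<in> borel_measurable borel"
proof -
  have "(\<lambda>x. if x \<in> cone_of D then gauge_fun D x else 0) \<in> borel_measurable borel"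
    using D by (intro borel_measurable_continuous_on_if)
      (auto simp: shape_class_def borel_open open_cone)
  then have [measurable]: "(\<lambda>x. if x \<in> cone_of D then gauge_fun D x else 0) \<in> borel_measurable borel" .
  have [measurable]: "cone_of D \<in> sets borel" by (rule borel_open[OF open_cone])
  have "intensity = (\<lambda>x. if x \<in> cone_of D
      then 1 / (if x \<in> cone_of D then gauge_fun D x else 0) powr (lam + real CARD('d)) else 0)"
    by (auto simp: intensity_def)
  also have "\<dots> \<in> borel_measurable borel" by measurable
  finally show ?thesis .
qed

lemma sets_rho [simp, measurable_cong]: "sets rho = sets borel"
  by (simp add: rho_def)

lemma space_rho [simp]: "space rho = UNIV"
  by (simp add: rho_def)

lemma intensity_scale:
  assumes "0 < t" "x \<noteq> 0"
  shows "intensity (t *\<^sub>R x) = t powr - (lam + real CARD('d)) * intensity x"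
  using assms gauge_pos[of x]
  by (auto simp: intensity_def cone_scale gauge_scale powr_mult powr_minus_divide simp del: minus_add_distrib)

text \<open>Volume contributes \<open>t\<close> to the power \<open>d\<close> and the intensity
  \<open>t\<close> to the power \<open>- (lam + d)\<close>. The resulting homogeneity of degree
  \<open>- lam\<close> is the source of the Frechet marginals.\<close>

lemma rho_dilate:
  assumes [measurable]: "A \<in> sets borel" and t: "0 < t"
  shows "emeasure rho {x. (1 / t) *\<^sub>R x \<in> A} = ennreal (t powr - lam) * emeasure rho A"
proof -
  have [measurable]: "intensity \<in> borel_measurable borel" by (rule intensity_measurable)
  have "emeasure rho {x. (1 / t) *\<^sub>R x \<in> A}
      = ennreal (t ^ CARD('d)) * (\<integral>\<^sup>+x. ennreal (intensity (t *\<^sub>R x)) * indicator A x \<partial>lborel)"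
    unfolding rho_def using emeasure_density_dilate[OF _ assms, of "\<lambda>x. ennreal (intensity x)"] by simp
  also have "(\<integral>\<^sup>+x. ennreal (intensity (t *\<^sub>R x)) * indicator A x \<partial>lborel)
     = (\<integral>\<^sup>+x. ennreal (t powr - (lam + real CARD('d))) * (ennreal (intensity x) * indicator A x) \<partial>lborel)"
  proof (rule nn_integral_cong_AE)
    have "AE x in lborel. x \<noteq> (0 :: real^'d)" by (rule AE_lborel_singleton)
    then show "AE x in lborel. ennreal (intensity (t *\<^sub>R x)) * indicator A x
      = ennreal (t powr - (lam + real CARD('d))) * (ennreal (intensity x) * indicator A x)"
      by eventually_elim (simp add: intensity_scale t intensity_nonneg ennreal_mult mult.assoc)
  qed
  also have "\<dots> = ennreal (t powr - (lam + real CARD('d))) * emeasure rho A"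
    unfolding rho_def by (subst nn_integral_cmult) (auto simp: emeasure_density)
  also have "ennreal (t ^ CARD('d)) * \<dots> = ennreal (t ^ CARD('d) * t powr - (lam + real CARD('d))) * emeasure rho A"
    using t by (simp add: ennreal_mult mult.assoc)
  also have "t ^ CARD('d) * t powr - (lam + real CARD('d)) = t powr - lam"
    using t by (simp add: powr_realpow[symmetric] powr_add[symmetric])
  finally show ?thesis .
qed

text \<open>The intensity is positive at every nonzero point of the cone, and a nonempty open set is
  not negligible. Both the nondegeneracy of the marginals and the lower bound on joint tails come
  from here.\<close>

lemma rho_open_pos:
  assumes "open U" "U \<inter> cone_of D \<noteq> {}"
  shows "0 < emeasure rho U"
proof (rule ccontr)
  assume "\<not> 0 < emeasure rho U"
  then have z: "emeasure rho U = 0" by (simp add: not_less)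
  have [measurable]: "intensity \<in> borel_measurable borel" by (rule intensity_measurable)
  have Um[measurable]: "U \<in> sets borel" using assms by auto
  have "AE x in lborel. ennreal (intensity x) * indicator U x = 0"
    using z unfolding rho_def by (simp add: emeasure_density nn_integral_0_iff_AE)
  moreover have "AE x in lborel. x \<noteq> (0 :: real^'d)" by (rule AE_lborel_singleton)
  ultimately have "AE x in lborel. x \<notin> U \<inter> cone_of D"
  proof eventually_elim
    case (elim x)
    then show ?case using gauge_pos[of x] by (auto simp: intensity_def indicator_def split: if_splits)
  qed
  then have "U \<inter> cone_of D \<in> null_sets lborel"
    using open_cone by (subst AE_iff_null_sets) auto
  moreover have "open (U \<inter> cone_of D)" using assms open_cone by auto
  ultimately show False using assms(2) open_not_negligible negligible_iff_null_sets
    by (metis null_sets_completionI)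
qed

end

section \<open>Tail asymptotics of the law with density f\<close>

locale tail_setting = gauge_setting D lam for D :: "(real^'d) set" and lam :: real +
  fixes f :: "real^'d \<Rightarrow> real" and f0 :: "real \<Rightarrow> real"
  assumes f0_cont: "continuous_on {0..} f0"
    and f0_decr: "strict_antimono_on {0..} f0"
    and f0_pos: "\<And>t. 0 \<le> t \<Longrightarrow> 0 < f0 t"
    and f0_rv: "regularly_varying f0 (- (lam + real CARD('d)))"
    and f_nonneg: "\<And>x. 0 \<le> f x"
    and f_meas [measurable]: "f \<in> borel_measurable borel"
    and f_asymp: "asymp_to_gauge f f0 D"
    and f_prob: "prob_space (density lborel (\<lambda>x. ennreal (f x)))"
begin

definition mu :: "(real^'d) measure" where
  "mu = density lborel (\<lambda>x. ennreal (f x))"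

definition tau :: "real \<Rightarrow> real" where
  "tau t = t ^ CARD('d) * f0 t"

lemma sets_mu [simp, measurable_cong]: "sets mu = sets borel"
  by (simp add: mu_def)

lemma space_mu [simp]: "space mu = UNIV"
  by (simp add: mu_def)

sublocale mu: prob_space mu
  unfolding mu_def by (rule f_prob)

lemma tau_pos: "0 < t \<Longrightarrow> 0 < tau t"
  by (simp add: tau_def f0_pos)

lemma f0_antimono: "0 \<le> s \<Longrightarrow> s \<le> t \<Longrightarrow> f0 t \<le> f0 s"
  using f0_decr by (cases "s = t") (auto simp: monotone_on_def intro: less_imp_le)

lemma f0_ratio:
  "0 < x \<Longrightarrow> ((\<lambda>t. f0 (t * x) / f0 t) \<longlongrightarrow> x powr - (lam + real CARD('d))) at_top"
  using f0_rv by (simp add: regularly_varying_def)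

text \<open>Potter's bound restricted to powers of \<open>2\<close>: the ratio
  \<open>f0 (2 * t) / f0 t\<close> is eventually below \<open>q\<close>, and iterating this costs
  one factor \<open>q\<close> per doubling.\<close>

lemma f0_doubling_bound:
  "\<exists>q T. 0 < q \<and> q * 2 ^ CARD('d) < 1 \<and> 0 < T \<and> (\<forall>t\<ge>T. \<forall>k. f0 (2 ^ k * t) \<le> q ^ k * f0 t)"
proof -
  \<comment> \<open>Half of \<open>lam\<close> is given away: \<open>q\<close> exceeds the limiting
    ratio \<open>2 powr - (lam + d)\<close> but stays below \<open>2 powr - d\<close>, the threshold
    for an integrable majorant.\<close>
  define q :: real where "q = 2 powr - (real CARD('d) + lam / 2)"
  have q: "0 < q" by (simp add: q_def)
  have "q * 2 ^ CARD('d) = 2 powr - (lam / 2)"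
    by (simp add: q_def powr_realpow[symmetric] powr_add[symmetric])
  also have "\<dots> < 2 powr 0" using lam by (intro powr_less_mono) auto
  finally have q2: "q * 2 ^ CARD('d) < 1" by simp
  have "2 powr - (lam + real CARD('d)) < q"
    unfolding q_def using lam by (intro powr_less_mono) auto
  then have "\<forall>\<^sub>F t in at_top. f0 (t * 2) / f0 t < q"
    using f0_ratio[of 2] by (intro order_tendstoD) auto
  then obtain T0 where T0: "\<And>t. T0 \<le> t \<Longrightarrow> f0 (t * 2) / f0 t < q"
    by (auto simp: eventually_at_top_linorder)
  define T where "T = max T0 1"
  have T: "0 < T" by (simp add: T_def)
  have "f0 (2 ^ k * t) \<le> q ^ k * f0 t" if t: "T \<le> t" for t k
  proof (induction k)
    case (Suc k)
    have "1 * t \<le> 2 ^ k * t" using t T by (intro mult_right_mono) auto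
    then have kt: "T \<le> 2 ^ k * t" using t by linarith
    have p: "0 < f0 (2 ^ k * t)" by (rule f0_pos) (use kt T in linarith)
    have "f0 (2 ^ k * t * 2) / f0 (2 ^ k * t) < q"
      by (rule T0) (use kt in \<open>simp add: T_def\<close>)
    then have "f0 (2 ^ Suc k * t) \<le> q * f0 (2 ^ k * t)"
      using p by (simp add: divide_less_eq mult_ac)
    also have "\<dots> \<le> q * (q ^ k * f0 t)" using Suc q by (intro mult_left_mono) auto
    finally show ?case by (simp add: mult_ac)
  qed simp
  then show ?thesis using q q2 T by blast
qed

lemma f_upper_bound:
  "\<exists>R0>0. \<forall>x. R0 \<le> norm x \<longrightarrow> f x \<le> (if x \<in> cone_of D then 2 * f0 (gauge_fun D x) else 0)"
proof -
  have "((\<lambda>x. f x / f0 (gauge_fun D x)) \<longlongrightarrow> 1) (inf at_infinity (principal (cone_of D)))"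
    using f_asymp by (simp add: asymp_to_gauge_def)
  then have "\<forall>\<^sub>F x in inf at_infinity (principal (cone_of D)). f x / f0 (gauge_fun D x) < 2"
    by (rule order_tendstoD) simp
  then obtain b where b: "\<And>x. b \<le> norm x \<Longrightarrow> x \<in> cone_of D \<Longrightarrow> f x / f0 (gauge_fun D x) < 2"
    by (auto simp: eventually_inf_principal eventually_at_infinity)
  have "f x \<le> (if x \<in> cone_of D then 2 * f0 (gauge_fun D x) else 0)" if "max b 1 \<le> norm x" for x
  proof (cases "x \<in> cone_of D")
    case True
    have "f x / f0 (gauge_fun D x) < 2" by (rule b) (use that True in auto)
    then show ?thesis using True f0_pos[OF gauge_nonneg[OF True]] by (simp add: divide_less_eq)
  next
    case False
    then show ?thesis using f_asymp by (simp add: asymp_to_gauge_def)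
  qed
  then show ?thesis by (intro exI[of _ "max b 1"]) auto
qed

text \<open>On the cone, homogeneity of the gauge splits the quotient into
  \<open>f (t y) / f0 (n (t y))\<close>, which tends to \<open>1\<close>, and
  \<open>f0 (t * n y) / f0 t\<close>, governed by regular variation, where \<open>n\<close> is the
  gauge. Off the cone both sides vanish.\<close>

lemma ray_limit:
  assumes "y \<noteq> 0"
  shows "((\<lambda>t. f (t *\<^sub>R y) / f0 t) \<longlongrightarrow> intensity y) at_top"
proof (cases "y \<in> cone_of D")
  case True
  let ?n = "gauge_fun D y"
  have n: "0 < ?n" using gauge_pos True assms by blast
  have lim: "filterlim (\<lambda>t. t *\<^sub>R y) (inf at_infinity (principal (cone_of D))) at_top"
    unfolding filterlim_inf
  proof
    have "filterlim (\<lambda>t. \<bar>t\<bar> * norm y) at_top at_top"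
      using assms by (intro filterlim_at_top_mult_tendsto_pos[OF tendsto_const] filterlim_abs_real) 
        (auto simp: mult.commute)
    then show "filterlim (\<lambda>t. t *\<^sub>R y) at_infinity at_top"
      by (subst filterlim_at_infinity_conv_norm_at_top) simp
    show "filterlim (\<lambda>t. t *\<^sub>R y) (principal (cone_of D)) at_top"
      unfolding filterlim_principal using eventually_gt_at_top[of 0]
      by eventually_elim (simp add: cone_scale True)
  qed
  have "((\<lambda>x. f x / f0 (gauge_fun D x)) \<longlongrightarrow> 1) (inf at_infinity (principal (cone_of D)))"
    using f_asymp by (simp add: asymp_to_gauge_def)
  from filterlim_compose[OF this lim]
  have "((\<lambda>t. f (t *\<^sub>R y) / f0 (gauge_fun D (t *\<^sub>R y)) * (f0 (t * ?n) / f0 t))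
    \<longlongrightarrow> 1 * ?n powr - (lam + real CARD('d))) at_top"
    by (intro tendsto_mult f0_ratio n)
  also have "1 * ?n powr - (lam + real CARD('d)) = intensity y"
    using True by (simp only: intensity_def powr_minus_divide if_True mult_1)
  finally show ?thesis
  proof (rule Lim_transform_eventually)
    show "\<forall>\<^sub>F t in at_top. f (t *\<^sub>R y) / f0 (gauge_fun D (t *\<^sub>R y)) * (f0 (t * ?n) / f0 t) = f (t *\<^sub>R y) / f0 t"
      using eventually_gt_at_top[of 0]
    proof eventually_elim
      case (elim t)
      have "f0 (t * ?n) \<noteq> 0" using f0_pos[of "t * ?n"] elim n by simp
      then show ?case by (simp add: gauge_scale True elim)
    qed
  qed
next
  case False
  show ?thesis
  proof (rule tendsto_eventually)
    show "\<forall>\<^sub>F t in at_top. f (t *\<^sub>R y) / f0 t = intensity y"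
      using eventually_gt_at_top[of 0]
    proof eventually_elim
      case (elim t)
      then have "t *\<^sub>R y \<notin> cone_of D" using False cone_scale by blast
      then show ?case using f_asymp False by (simp add: asymp_to_gauge_def intensity_def)
    qed
  qed
qed

text \<open>If \<open>norm y\<close> lies between \<open>2 ^ k * \<epsilon>\<close> and
  \<open>2 ^ Suc k * \<epsilon>\<close>, the gauge of \<open>t y\<close> is at least
  \<open>2 ^ k * (t * a)\<close> with \<open>a = \<epsilon> / R\<close>. Monotonicity of
  \<open>f0\<close> and the doubling bound then give a factor \<open>q ^ k\<close>, which the dyadic
  majorant dominates at \<open>y\<close>. The requirements on \<open>t\<close> ensure
  \<open>T \<le> t * a\<close> and \<open>R0 \<le> norm (t y)\<close>.\<close>

lemma tail_majorant:
  assumes "0 < \<epsilon>"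
  shows "\<exists>w. integrable lborel w \<and>
    (\<forall>\<^sub>F t in at_top. \<forall>y. \<epsilon> \<le> norm y \<longrightarrow> f (t *\<^sub>R y) / f0 t \<le> w y)"
proof -
  obtain R where R: "0 < R" "\<And>x. x \<in> cone_of D \<Longrightarrow> norm x / R \<le> gauge_fun D x"
    using gauge_lower_bound by blast
  obtain q T where q: "0 < q" "q * 2 ^ CARD('d) < 1" and T: "0 < T"
    and dbl: "\<And>t k. T \<le> t \<Longrightarrow> f0 (2 ^ k * t) \<le> q ^ k * f0 t"
    using f0_doubling_bound by blast
  obtain R0 where R0: "0 < R0"
    "\<And>x. R0 \<le> norm x \<Longrightarrow> f x \<le> (if x \<in> cone_of D then 2 * f0 (gauge_fun D x) else 0)"
    using f_upper_bound by blast
  have "q * 1 \<le> q * 2 ^ CARD('d)" using q by (intro mult_left_mono) auto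
  then have q1: "q < 1" using q(2) by linarith
  define a where "a = \<epsilon> / R"
  have a: "0 < a" using assms R by (simp add: a_def)
  \<comment> \<open>One more than the limit of \<open>f0 (t * a) / f0 t\<close>, hence eventually an
    upper bound for this ratio.\<close>
  define B where "B = a powr - (lam + real CARD('d)) + 1"
  have "0 \<le> a powr - (lam + real CARD('d))" by simp
  then have B: "0 < B" unfolding B_def by linarith
  let ?G = "dyadic_majorant q \<epsilon> :: real^'d \<Rightarrow> real"
  have ev: "\<forall>\<^sub>F t in at_top. f0 (t * a) / f0 t < B"
    by (rule order_tendstoD[OF f0_ratio[OF a]]) (simp add: B_def)
  have "\<forall>\<^sub>F t in at_top. \<forall>y. \<epsilon> \<le> norm y \<longrightarrow> f (t *\<^sub>R y) / f0 t \<le> 2 * B * ?G y"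
    using ev eventually_ge_at_top[of "T / a"] eventually_ge_at_top[of "R0 / \<epsilon>"] eventually_gt_at_top[of 0]
  proof eventually_elim
    case (elim t)
    have ft: "0 < f0 t" using f0_pos elim(4) by simp
    show ?case
    proof (intro allI impI)
      fix y :: "real^'d" assume y: "\<epsilon> \<le> norm y"
      obtain k where k: "2 ^ k * \<epsilon> \<le> norm y" "norm y < 2 ^ Suc k * \<epsilon>"
        using dyadic_scale_exists[OF assms y] by blast
      have G: "q ^ k \<le> ?G y" by (rule dyadic_majorant_ge[OF q(1) q1 k(2)])
      have "0 \<le> ?G y" by (rule order_trans[OF _ G]) (use q in simp)
      have "R0 \<le> t * \<epsilon>" using elim(3) assms by (simp add: divide_le_eq)
      also have "\<dots> \<le> norm (t *\<^sub>R y)" using y elim(4) by simp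
      finally have f: "f (t *\<^sub>R y) \<le> (if t *\<^sub>R y \<in> cone_of D then 2 * f0 (gauge_fun D (t *\<^sub>R y)) else 0)"
        by (rule R0(2))
      show "f (t *\<^sub>R y) / f0 t \<le> 2 * B * ?G y"
      proof (cases "t *\<^sub>R y \<in> cone_of D")
        case False
        then have "f (t *\<^sub>R y) / f0 t \<le> 0" using f ft by (simp add: divide_le_eq)
        then show ?thesis using \<open>0 \<le> ?G y\<close> B by (meson mult_nonneg_nonneg order_trans less_imp_le zero_le_numeral)
      next
        case True
        have "2 ^ k * (t * a) = t * (2 ^ k * \<epsilon>) / R" by (simp add: a_def)
        also have "\<dots> \<le> t * norm y / R"
          using k(1) elim(4) R(1) by (intro divide_right_mono mult_left_mono) auto
        also have "\<dots> = norm (t *\<^sub>R y) / R" using elim(4) by simp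
        also have "\<dots> \<le> gauge_fun D (t *\<^sub>R y)" by (rule R(2)[OF True])
        finally have le: "2 ^ k * (t * a) \<le> gauge_fun D (t *\<^sub>R y)" .
        have "f0 (gauge_fun D (t *\<^sub>R y)) \<le> f0 (2 ^ k * (t * a))"
          by (rule f0_antimono[OF _ le]) (use elim(4) a in simp)
        also have "\<dots> \<le> q ^ k * f0 (t * a)"
          by (rule dbl) (use elim(2) a in \<open>simp add: divide_le_eq\<close>)
        also have "\<dots> \<le> q ^ k * (B * f0 t)"
          using elim(1) ft q(1) by (intro mult_left_mono) (auto simp: divide_less_eq)
        also have "\<dots> \<le> ?G y * (B * f0 t)"
          using G B ft by (intro mult_right_mono) auto
        finally have "f (t *\<^sub>R y) \<le> 2 * (?G y * (B * f0 t))" using f True by simp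
        then show ?thesis using ft by (simp add: divide_le_eq mult_ac)
      qed
    qed
  qed
  moreover have "integrable lborel (\<lambda>y. 2 * B * ?G y)"
    using q assms by (intro integrable_mult_right dyadic_majorant_integrable) auto
  ultimately show ?thesis by blast
qed

lemma tail_limit:
  assumes A [measurable]: "A \<in> sets borel" and \<epsilon>: "0 < \<epsilon>" "\<And>y. y \<in> A \<Longrightarrow> \<epsilon> \<le> norm y"
  shows "((\<lambda>t. measure mu {x. (1 / t) *\<^sub>R x \<in> A} / tau t) \<longlongrightarrow> measure rho A) at_top"
    and "emeasure rho A < \<infinity>"
proof -
  obtain w where w: "integrable lborel w"
    and wb: "\<forall>\<^sub>F t in at_top. \<forall>y. \<epsilon> \<le> norm y \<longrightarrow> f (t *\<^sub>R y) / f0 t \<le> w y"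
    using tail_majorant[OF \<epsilon>(1)] by blast
  have [measurable]: "intensity \<in> borel_measurable borel" by (rule intensity_measurable)
  let ?s = "\<lambda>t y. indicator A y * (f (t *\<^sub>R y) / f0 t) :: real"
  let ?r = "\<lambda>y. indicator A y * intensity y :: real"
  have lim: "AE y in lborel. ((\<lambda>t. ?s t y) \<longlongrightarrow> ?r y) at_top"
  proof (rule AE_I2)
    fix y
    show "((\<lambda>t. ?s t y) \<longlongrightarrow> ?r y) at_top"
    proof (cases "y \<in> A")
      case True
      then have "y \<noteq> 0" using \<epsilon> by force
      then show ?thesis by (intro tendsto_mult tendsto_const ray_limit)
    qed simp
  qed
  have bound: "\<forall>\<^sub>F t in at_top. AE y in lborel. norm (?s t y) \<le> norm (w y)"
    using wb eventually_gt_at_top[of 0]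
  proof eventually_elim
    case (elim t)
    show ?case
    proof (rule AE_I2)
      fix y
      have 0: "0 \<le> f (t *\<^sub>R y) / f0 t"
        using f_nonneg f0_pos[of t] elim(2) by simp
      show "norm (?s t y) \<le> norm (w y)"
      proof (cases "y \<in> A")
        case True
        then have "f (t *\<^sub>R y) / f0 t \<le> w y" using elim(1) \<epsilon>(2) by blast
        then have "\<bar>f (t *\<^sub>R y) / f0 t\<bar> \<le> \<bar>w y\<bar>" using 0 by linarith
        then show ?thesis using True by simp
      qed simp
    qed
  qed
  have ms: "?s t \<in> borel_measurable lborel" for t by measurable
  have mr: "?r \<in> borel_measurable lborel" by measurable
  have int: "((\<lambda>t. \<integral>y. ?s t y \<partial>lborel) \<longlongrightarrow> (\<integral>y. ?r y \<partial>lborel)) at_top"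
    by (rule integral_dominated_convergence_at_top[OF mr ms integrable_norm[OF w] lim bound])
  \<comment> \<open>The same domination makes the limit integrable, which is the finiteness
    claim.\<close>
  have intr: "integrable lborel ?r"
    by (rule integrable_dominated_convergence_at_top[OF mr ms integrable_norm[OF w] lim bound])
  have er: "emeasure rho A = (\<integral>\<^sup>+y. ennreal (?r y) \<partial>lborel)"
    unfolding rho_def by (subst emeasure_density) (auto intro!: nn_integral_cong simp: indicator_def)
  also have "\<dots> = ennreal (\<integral>y. ?r y \<partial>lborel)"
    by (rule nn_integral_eq_integral[OF intr]) (simp add: intensity_nonneg)
  finally have er2: "emeasure rho A = ennreal (\<integral>y. ?r y \<partial>lborel)" .
  then show "emeasure rho A < \<infinity>" by simp
  have "measure rho A = (\<integral>y. ?r y \<partial>lborel)"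
    unfolding measure_def er2 by (simp add: intensity_nonneg)
  with int have "((\<lambda>t. \<integral>y. ?s t y \<partial>lborel) \<longlongrightarrow> measure rho A) at_top" by simp
  then show "((\<lambda>t. measure mu {x. (1 / t) *\<^sub>R x \<in> A} / tau t) \<longlongrightarrow> measure rho A) at_top"
  proof (rule Lim_transform_eventually)
    show "\<forall>\<^sub>F t in at_top. (\<integral>y. ?s t y \<partial>lborel) = measure mu {x. (1 / t) *\<^sub>R x \<in> A} / tau t"
      using eventually_gt_at_top[of 0]
    proof eventually_elim
      case (elim t)
      have ft: "0 < f0 t" using f0_pos elim by simp
      have "emeasure mu {x. (1 / t) *\<^sub>R x \<in> A}
          = ennreal (t ^ CARD('d)) * (\<integral>\<^sup>+x. ennreal (f (t *\<^sub>R x)) * indicator A x \<partial>lborel)"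
        unfolding mu_def using emeasure_density_dilate[OF _ A elim, of "\<lambda>x. ennreal (f x)"] by simp
      also have "(\<integral>\<^sup>+x. ennreal (f (t *\<^sub>R x)) * indicator A x \<partial>lborel)
          = (\<integral>\<^sup>+x. ennreal (f0 t) * ennreal (?s t x) \<partial>lborel)"
        using ft f_nonneg by (intro nn_integral_cong) (auto simp: indicator_def simp flip: ennreal_mult)
      also have "\<dots> = ennreal (f0 t) * (\<integral>\<^sup>+x. ennreal (?s t x) \<partial>lborel)"
        by (rule nn_integral_cmult) measurable
      finally have "measure mu {x. (1 / t) *\<^sub>R x \<in> A} = t ^ CARD('d) * (f0 t * enn2real (\<integral>\<^sup>+x. ennreal (?s t x) \<partial>lborel))"
        using ft elim by (simp add: measure_def enn2real_mult)
      also have "enn2real (\<integral>\<^sup>+x. ennreal (?s t x) \<partial>lborel) = (\<integral>y. ?s t y \<partial>lborel)"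
        by (rule integral_eq_nn_integral[symmetric]) (use ft f_nonneg in auto)
      finally show ?case using ft elim by (simp add: tau_def)
    qed
  qed
qed

lemma dilate_upper_orthant:
  assumes "0 < t"
  shows "{x :: real^'d. (1 / t) *\<^sub>R x \<in> {x. \<exists>i\<in>J. w i < x $ i}} = {x. \<exists>i\<in>J. t * w i < x $ i}"
  using assms by (auto simp: field_simps)

text \<open>Exceeding a positive threshold in one coordinate forces the norm above the least
  threshold, so the set is bounded away from the origin and \<open>tail_limit\<close>
  applies.\<close>

lemma upper_orthant_limit:
  fixes w :: "'d \<Rightarrow> real"
  assumes w: "\<forall>i\<in>J. 0 < w i"
  shows "((\<lambda>t. measure mu {x. \<exists>i\<in>J. t * w i < x $ i} / tau t)
      \<longlongrightarrow> measure rho {x. \<exists>i\<in>J. w i < x $ i}) at_top"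
    and "emeasure rho {x. \<exists>i\<in>J. w i < x $ i} < \<infinity>"
proof -
  define \<epsilon> where "\<epsilon> = Min (insert 1 (w ` J))"
  have "finite J" by simp
  then have \<epsilon>: "0 < \<epsilon>" "\<And>i. i \<in> J \<Longrightarrow> \<epsilon> \<le> w i"
    using w by (auto simp: \<epsilon>_def)
  have nrm: "\<epsilon> \<le> norm y" if y: "y \<in> {x. \<exists>i\<in>J. w i < x $ i}" for y :: "real^'d"
  proof -
    obtain i where "i \<in> J" "w i < y $ i" using y by auto
    then show ?thesis using \<epsilon>(2)[of i] component_le_norm_cart[of y i] by linarith
  qed
  note lim = tail_limit[OF upper_orthant_borel \<epsilon>(1) nrm]
  show "emeasure rho {x. \<exists>i\<in>J. w i < x $ i} < \<infinity>" by (rule lim(2))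
  show "((\<lambda>t. measure mu {x. \<exists>i\<in>J. t * w i < x $ i} / tau t)
      \<longlongrightarrow> measure rho {x. \<exists>i\<in>J. w i < x $ i}) at_top"
  proof (rule Lim_transform_eventually[OF lim(1)])
    show "\<forall>\<^sub>F t in at_top. measure mu {x. (1 / t) *\<^sub>R x \<in> {x. \<exists>i\<in>J. w i < x $ i}} / tau t
      = measure mu {x. \<exists>i\<in>J. t * w i < x $ i} / tau t"
      using eventually_gt_at_top[of 0] by eventually_elim (simp only: dilate_upper_orthant)
  qed
qed

lemma coordinate_limit:
  assumes c: "0 < c"
  shows "((\<lambda>t. measure mu {x. t * c < x $ i} / tau t) \<longlongrightarrow> measure rho {x. c < x $ i}) at_top"
  using upper_orthant_limit(1)[of "{i}" "\<lambda>_. c"] c by simp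

lemma rho_coordinate_scale:
  assumes t: "0 < t"
  shows "measure rho {x. t < x $ i} = t powr - lam * measure rho {x. 1 < x $ i}"
proof -
  have "emeasure rho {x. t < x $ i} = ennreal (t powr - lam) * emeasure rho {x. 1 < x $ i}"
    using rho_dilate[OF upper_orthant_borel[of "{i}" "\<lambda>_. 1"] t] dilate_upper_orthant[OF t, of "{i}" "\<lambda>_. 1"]
    by simp
  then show ?thesis by (simp add: measure_def enn2real_mult)
qed

lemma rho_coordinate_pos:
  assumes x: "x \<in> D" "0 < x $ i"
  shows "0 < measure rho {x. 1 < x $ i}"
proof -
  let ?U = "{x :: real^'d. 1 < x $ i}"
  have "open ?U" by (intro open_Collect_less continuous_intros)
  \<comment> \<open>The multiple is chosen so that the \<open>i\<close>-th coordinate becomes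
    \<open>2\<close>.\<close>
  moreover have "(2 / x $ i) *\<^sub>R x \<in> ?U \<inter> cone_of D"
    using x cone_scale[of "2 / x $ i" x] mem_cone_iff[of x] by (auto intro!: exI[of _ 1])
  ultimately have "0 < emeasure rho ?U" by (intro rho_open_pos) blast+
  moreover have "emeasure rho ?U < \<infinity>"
    using upper_orthant_limit(2)[of "{i}" "\<lambda>_. 1"] by simp
  ultimately show ?thesis by (simp add: measure_def enn2real_positive_iff)
qed

lemma mu_coordinate_cdf: "measure mu {x. x $ i \<le> t} = 1 - measure mu {x. t < x $ i}"
proof -
  have "{x :: real^'d. x $ i \<le> t} = space mu - {x. t < x $ i}" by auto
  moreover have "{x :: real^'d. t < x $ i} \<in> sets mu"
    using upper_orthant_borel[of "{i}" "\<lambda>_. t"] by simp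
  ultimately show ?thesis using mu.prob_compl by metis
qed

lemma coordinate_distribution: "real_distribution (distr mu borel (\<lambda>x. x $ i))"
  by (rule mu.real_distribution_distr) measurable

lemma cdf_coordinate: "cdf (distr mu borel (\<lambda>x. x $ i)) t = measure mu {x. x $ i \<le> t}"
  unfolding cdf_def by (subst measure_distr) (auto intro!: arg_cong[where f="measure mu"])

lemma coordinate_tail_to_zero: "((\<lambda>t. measure mu {x. t < x $ i}) \<longlongrightarrow> 0) at_top"
proof -
  interpret real_distribution "distr mu borel (\<lambda>x. x $ i)" by (rule coordinate_distribution)
  have "((\<lambda>t. 1 - cdf (distr mu borel (\<lambda>x. x $ i)) t) \<longlongrightarrow> 1 - 1) at_top"
    by (intro tendsto_diff tendsto_const cdf_lim_at_top_prob)
  then show ?thesis by (simp add: cdf_coordinate mu_coordinate_cdf)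
qed

text \<open>Absolute continuity makes the marginal distribution functions continuous, so that
  quantiles are attained exactly in the dependence argument.\<close>

lemma mu_hyperplane_null: "measure mu {x. x $ j = c} = 0"
proof -
  have b: "{x :: real^'d. x $ j = c} \<in> sets borel" by measurable
  have "negligible {x :: real^'d. x \<bullet> axis j 1 = c}"
    by (rule negligible_standard_hyperplane) (simp add: axis_in_Basis_iff)
  then have "negligible {x :: real^'d. x $ j = c}" by (simp add: inner_axis)
  then have "{x :: real^'d. x $ j = c} \<in> null_sets lborel"
    using b by (simp add: negligible_iff_null_sets null_sets_completion_iff)
  then have "AE x in lborel. x \<notin> {x :: real^'d. x $ j = c}" by (rule AE_not_in)
  then have "AE x in mu. x \<notin> {x :: real^'d. x $ j = c}"
    unfolding mu_def by (subst AE_density) (auto elim!: eventually_mono)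
  then show ?thesis using b by (simp add: mu.prob_eq_0)
qed

end

section \<open>Scaling constants, the max-stable limit and asymptotic dependence\<close>

locale max_setting = tail_setting D lam f f0
  for D :: "(real^'d) set" and lam f f0 +
  assumes D_pos: "\<And>i. \<exists>x\<in>D. 0 < x $ i"
begin

lemma coordinate_mass_pos: "0 < measure rho {x. 1 < x $ i}"
  using D_pos[of i] rho_coordinate_pos by blast

text \<open>A marginal tail divided by \<open>tau\<close> has a positive limit, and the tail itself
  tends to \<open>0\<close>; hence so does \<open>tau\<close>.\<close>

lemma tau_to_zero: "(tau \<longlongrightarrow> 0) at_top"
proof -
  fix i :: 'd
  let ?p = "\<lambda>t. measure mu {x. t < x $ i}"
  have lim: "((\<lambda>t. ?p t / tau t) \<longlongrightarrow> measure rho {x. 1 < x $ i}) at_top"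
    using coordinate_limit[of 1 i] by simp
  have "((\<lambda>t. ?p t / (?p t / tau t)) \<longlongrightarrow> 0 / measure rho {x. 1 < x $ i}) at_top"
    using coordinate_mass_pos[of i] by (intro tendsto_divide coordinate_tail_to_zero lim) simp
  then have "((\<lambda>t. ?p t / (?p t / tau t)) \<longlongrightarrow> 0) at_top" by simp
  moreover have "\<forall>\<^sub>F t in at_top. ?p t / (?p t / tau t) = tau t"
    using order_tendstoD(1)[OF lim coordinate_mass_pos] by eventually_elim auto
  ultimately show ?thesis by (rule Lim_transform_eventually)
qed

lemma tau_continuous: "continuous_on {1..} tau"
  unfolding tau_def by (intro continuous_intros continuous_on_subset[OF f0_cont]) auto

text \<open>For large \<open>n\<close> the level \<open>1 / n\<close> lies below
  \<open>tau 1\<close> and above \<open>tau\<close> far out, so the intermediate value theorem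
  solves \<open>tau x = 1 / n\<close> on the half-line from \<open>1\<close>.\<close>

lemma scaling_sequence_exists:
  "\<exists>s. (\<forall>n. 0 < s n) \<and> filterlim s at_top sequentially \<and> (\<lambda>n. real n * tau (s n)) \<longlonglongrightarrow> 1"
proof -
  \<comment> \<open>The fallback value \<open>1\<close> concerns only finitely many \<open>n\<close>
    and keeps the sequence positive.\<close>
  define s where "s n = (if \<exists>x\<ge>1. tau x = 1 / real n then SOME x. 1 \<le> x \<and> tau x = 1 / real n else 1)" for n
  have s1: "1 \<le> s n" for n
    unfolding s_def by (auto intro: someI2)
  have "\<forall>\<^sub>F n in sequentially. 1 / real n < tau 1"
    by (rule order_tendstoD[OF lim_1_over_n]) (simp add: tau_pos)
  then have s2: "\<forall>\<^sub>F n in sequentially. tau (s n) = 1 / real n"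
    using eventually_gt_at_top[of 0]
  proof eventually_elim
    case (elim n)
    have "\<forall>\<^sub>F t in at_top. tau t < 1 / real n"
      by (rule order_tendstoD[OF tau_to_zero]) (use elim in simp)
    then obtain b where b: "\<And>t. b \<le> t \<Longrightarrow> tau t < 1 / real n" by (auto simp: eventually_at_top_linorder)
    have "\<exists>x\<ge>1. x \<le> max b 1 \<and> tau x = 1 / real n"
    proof (rule IVT2')
      show "tau (max b 1) \<le> 1 / real n" using b[of "max b 1"] by simp
    qed (use elim in \<open>auto intro: continuous_on_subset[OF tau_continuous]\<close>)
    then have ex: "\<exists>x. 1 \<le> x \<and> tau x = 1 / real n" by blast
    then show ?case using someI_ex[OF ex] by (simp add: s_def)
  qed
  have "filterlim s at_top sequentially"
    unfolding filterlim_at_top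
  proof
    fix Z :: real
    \<comment> \<open>On a compact interval \<open>tau\<close> has a positive minimum. Once
      \<open>1 / n\<close> is below it, the solution \<open>s n\<close> must lie beyond the
      interval.\<close>
    have "\<exists>x\<in>{1..max Z 1}. \<forall>y\<in>{1..max Z 1}. tau x \<le> tau y"
      by (intro continuous_attains_inf continuous_on_subset[OF tau_continuous]) auto
    then obtain x where x: "1 \<le> x" "\<And>y. 1 \<le> y \<Longrightarrow> y \<le> max Z 1 \<Longrightarrow> tau x \<le> tau y"
      by auto
    have "\<forall>\<^sub>F n in sequentially. 1 / real n < tau x"
      by (rule order_tendstoD[OF lim_1_over_n]) (use x in \<open>simp add: tau_pos\<close>)
    then show "\<forall>\<^sub>F n in sequentially. Z \<le> s n"
      using s2
    proof eventually_elim
      case (elim n)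
      show ?case
      proof (rule ccontr)
        assume "\<not> Z \<le> s n"
        then have "tau x \<le> tau (s n)" using s1[of n] by (intro x(2)) auto
        then show False using elim by simp
      qed
    qed
  qed
  moreover have "(\<lambda>n. real n * tau (s n)) \<longlonglongrightarrow> 1"
  proof (rule tendsto_eventually)
    show "\<forall>\<^sub>F n in sequentially. real n * tau (s n) = 1"
      using s2 eventually_gt_at_top[of 0] by eventually_elim simp
  qed
  moreover have "0 < s n" for n using s1[of n] by linarith
  ultimately show ?thesis by blast
qed

text \<open>With \<open>p n\<close> the probability that one scaled copy exceeds \<open>w\<close>
  somewhere, \<open>n * p n\<close> factors as \<open>p n / tau (s n)\<close> times
  \<open>n * tau (s n)\<close>. The second factor tends to \<open>1\<close>, which is why no
  constant other than \<open>c = 1\<close> appears.\<close>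

lemma scaled_max_cdf_tendsto:
  assumes s: "\<And>n. 0 < s n" "filterlim s at_top sequentially" "(\<lambda>n. real n * tau (s n)) \<longlonglongrightarrow> 1"
    and w: "\<And>i. 0 < w i"
  shows "(\<lambda>n. measure (scaled_max_law mu n (s n)) {x. \<forall>i. x $ i \<le> w i})
     \<longlonglongrightarrow> exp (- measure rho {x. \<exists>i\<in>UNIV. w i < x $ i})"
proof -
  let ?p = "\<lambda>t. measure mu {x. \<exists>i\<in>UNIV. t * w i < x $ i}"
  have "((\<lambda>n. ?p (s n) / tau (s n) * (real n * tau (s n)))
      \<longlonglongrightarrow> measure rho {x. \<exists>i\<in>UNIV. w i < x $ i} * 1)"
    by (intro tendsto_mult s(3) filterlim_compose[OF upper_orthant_limit(1) s(2)]) (use w in simp)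
  moreover have "?p (s n) / tau (s n) * (real n * tau (s n)) = real n * ?p (s n)" for n
    using tau_pos[OF s(1), of n] by simp
  ultimately have "(\<lambda>n. real n * ?p (s n)) \<longlonglongrightarrow> measure rho {x. \<exists>i\<in>UNIV. w i < x $ i}" by simp
  from power_one_minus_tendsto[OF this] show ?thesis
  proof (rule Lim_transform_eventually)
    show "\<forall>\<^sub>F n in sequentially. (1 - ?p (s n)) ^ n = measure (scaled_max_law mu n (s n)) {x. \<forall>i. x $ i \<le> w i}"
      using eventually_gt_at_top[of 0]
    proof eventually_elim
      case (elim n)
      have "measure (scaled_max_law mu n (s n)) {x. \<forall>i\<in>UNIV. x $ i \<le> w i}
        = measure mu {x. \<forall>i\<in>UNIV. x $ i \<le> s n * w i} ^ n"
        by (rule measure_scaled_max_law[OF mu.prob_space_axioms sets_mu elim s(1)])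
      also have "{x. \<forall>i\<in>UNIV. x $ i \<le> s n * w i} = space mu - {x. \<exists>i\<in>UNIV. s n * w i < x $ i}"
        by (auto simp flip: not_less)
      also have "measure mu \<dots> = 1 - ?p (s n)"
        by (rule mu.prob_compl) (simp only: sets_mu upper_orthant_borel)
      finally show ?case by simp
    qed
  qed
qed

text \<open>Since \<open>w\<close> is positive, the positive part fails to lie below
  \<open>w\<close> exactly when some coordinate of \<open>x\<close> itself exceeds that of
  \<open>w\<close>. Such \<open>x\<close> are nonzero, so removing the origin before or after taking
  the image does not affect the mass.\<close>

lemma gauge_measure_pos_eq_rho:
  assumes w: "\<And>i. 0 < w $ i"
  shows "emeasure (gauge_measure_pos D lam 1) ({0..} - {0..w}) = emeasure rho {x. \<exists>i\<in>UNIV. w $ i < x $ i}"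
proof -
  have gauge_eq: "gauge_measure D lam 1
      = density (restrict_space lborel (- {0})) (\<lambda>x. ennreal (intensity x))"
    unfolding gauge_measure_def intensity_def by (rule refl)
  have pm: "pos_part_vec \<in> borel_measurable (borel :: (real^'d) measure)"
    unfolding pos_part_vec_def by (rule borel_measurable_vec_lambda) measurable
  have sG: "sets (gauge_measure D lam 1) = sets (restrict_space borel (- {0}))"
    by (simp add: gauge_measure_def cong: sets_restrict_space_cong)
  have pmG: "pos_part_vec \<in> borel_measurable (gauge_measure D lam 1)"
    unfolding measurable_cong_sets[OF sG refl] by (rule measurable_restrict_space1[OF pm])
  have spG: "space (gauge_measure D lam 1) = - {0}"
    by (simp add: gauge_measure_def space_restrict_space)
  have cl: "{0..} \<in> sets (borel :: (real^'d) measure)" "{0..w} \<in> sets borel"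
  proof -
    have "{0..} = {x :: real^'d. \<forall>i. 0 \<le> x $ i}" by (auto simp: less_eq_vec_def)
    also have "\<dots> \<in> sets borel" by measurable
    finally show "{0..} \<in> sets (borel :: (real^'d) measure)" .
    show "{0..w} \<in> sets borel" by (simp add: interval_cbox_cart)
  qed
  have ne: "0 \<in> {0..w}" using w by (auto simp: less_eq_vec_def intro: less_imp_le)
  let ?U = "{x :: real^'d. \<exists>i\<in>UNIV. w $ i < x $ i}"
  have U: "?U \<in> sets borel" by (rule upper_orthant_borel)
  have vim: "pos_part_vec -` ({0..} - {0..w}) \<inter> - {0} = ?U"
  proof (intro set_eqI iffI)
    fix x assume "x \<in> pos_part_vec -` ({0..} - {0..w}) \<inter> - {0}"
    moreover have "0 \<le> pos_part_vec x" by (simp add: pos_part_vec_def less_eq_vec_def)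
    ultimately have "\<not> pos_part_vec x \<le> w" by simp
    then have "\<exists>i. w $ i < x $ i \<or> w $ i < 0"
      by (simp add: pos_part_vec_def less_eq_vec_def not_le)
    then obtain i where "w $ i < x $ i \<or> w $ i < 0" by blast
    then have "w $ i < x $ i" using w[of i] by linarith
    then show "x \<in> ?U" by blast
  next
    fix x assume "x \<in> ?U"
    then obtain i where i: "w $ i < x $ i" by auto
    then have "x \<noteq> 0" using w[of i] by auto
    moreover have "\<not> pos_part_vec x \<le> w"
      using i by (auto simp: pos_part_vec_def less_eq_vec_def not_le intro!: exI[of _ i])
    ultimately show "x \<in> pos_part_vec -` ({0..} - {0..w}) \<inter> - {0}"
      by (auto simp: pos_part_vec_def less_eq_vec_def)
  qed
  have "emeasure (gauge_measure_pos D lam 1) ({0..} - {0..w})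
      = emeasure (distr (gauge_measure D lam 1) borel pos_part_vec) ({0..} - {0..w})"
    unfolding gauge_measure_pos_def
    using ne cl by (intro emeasure_restrict_space) auto
  also have "\<dots> = emeasure (gauge_measure D lam 1) (pos_part_vec -` ({0..} - {0..w}) \<inter> space (gauge_measure D lam 1))"
    by (rule emeasure_distr[OF pmG]) (use cl in auto)
  also have "\<dots> = emeasure (gauge_measure D lam 1) ?U"
    by (simp only: spG vim)
  also have "\<dots> = (\<integral>\<^sup>+x. ennreal (intensity x) * indicator ?U x \<partial>restrict_space lborel (- {0}))"
    unfolding gauge_eq
  proof (rule emeasure_density)
    have [measurable]: "intensity \<in> borel_measurable borel" by (rule intensity_measurable)
    show "(\<lambda>x. ennreal (intensity x)) \<in> borel_measurable (restrict_space lborel (- {0}))"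
      by (rule measurable_restrict_space1) measurable
    have "?U \<subseteq> - {0}" using vim by blast
    then show "?U \<in> sets (restrict_space lborel (- {0}))"
      using U by (simp add: sets_restrict_space_iff)
  qed
  also have "\<dots> = (\<integral>\<^sup>+x. ennreal (intensity x) * indicator ?U x * indicator (- {0}) x \<partial>lborel)"
    by (rule nn_integral_restrict_space) simp
  also have "\<dots> = (\<integral>\<^sup>+x. ennreal (intensity x) * indicator ?U x \<partial>lborel)"
  proof (rule nn_integral_cong)
    fix x :: "real^'d"
    have "?U \<subseteq> - {0}" using vim by blast
    then show "ennreal (intensity x) * indicator ?U x * indicator (- {0}) x = ennreal (intensity x) * indicator ?U x"
      by (auto simp: indicator_def)
  qed
  also have "\<dots> = emeasure rho ?U"
  proof -
    have [measurable]: "intensity \<in> borel_measurable borel" by (rule intensity_measurable)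
    show ?thesis unfolding rho_def by (subst emeasure_density) (use U in auto)
  qed
  finally show ?thesis .
qed

lemma frechet_limit_exists:
  "\<exists>s a \<nu>. frechet_max_limit mu lam s a \<nu> \<and> is_exponent_measure (gauge_measure_pos D lam 1) \<nu>"
proof -
  obtain s where s: "\<And>n. 0 < s n" "filterlim s at_top sequentially" "(\<lambda>n. real n * tau (s n)) \<longlonglongrightarrow> 1"
    using scaling_sequence_exists by blast
  have "emeasure rho {x. \<exists>i. \<epsilon> < x $ i} < \<infinity>" if "0 < \<epsilon>" for \<epsilon>
    using upper_orthant_limit(2)[of UNIV "\<lambda>_. \<epsilon>"] that by simp
  from poisson_supremum_exists[OF sets_rho this]
  obtain \<nu> where p\<nu>: "prob_space \<nu>" and s\<nu>: "sets \<nu> = sets borel"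
    and \<nu>: "\<And>J w. (\<forall>i\<in>J. 0 < w i) \<Longrightarrow>
       measure \<nu> {x. \<forall>i\<in>J. x $ i \<le> w i} = exp (- measure rho {x. \<exists>i\<in>J. w i < x $ i})"
    by blast
  interpret \<nu>: prob_space \<nu> by fact
  have sp\<nu>: "space \<nu> = UNIV" using sets_eq_imp_space_eq[OF s\<nu>] by simp
  define m where "m i = measure rho {x. 1 < x $ i}" for i
  have m: "0 < m i" for i unfolding m_def by (rule coordinate_mass_pos)
  \<comment> \<open>Chosen to turn the exponent \<open>t powr - lam * m i\<close>, obtained from
    homogeneity, into \<open>(a i / t) powr lam\<close>.\<close>
  define a where "a i = m i powr (1 / lam)" for i
  have a: "0 < a i" for i using m[of i] by (simp add: a_def)
  have marg0: "measure \<nu> {x. x $ i \<le> t} = exp (- (t powr - lam * m i))" if "0 < t" for i t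
    using \<nu>[of "{i}" "\<lambda>_. t"] rho_coordinate_scale[OF that, of i] that by (simp add: m_def)
  have marg: "measure \<nu> {x. x $ i \<le> t} = exp (- ((a i / t) powr lam))" if t: "0 < t" for i t
  proof -
    have "(a i / t) powr lam = t powr - lam * m i"
      using t m[of i] a[of i] lam by (simp add: powr_divide a_def powr_powr powr_minus_divide)
    then show ?thesis using marg0[OF t] by simp
  qed
  have "AE x in \<nu>. 0 < x $ i" for i
  proof -
    have bi: "{x :: real^'d. x $ i \<le> t} \<in> sets \<nu>" for t
      using lower_orthant_borel[of "{i}" "\<lambda>_. t"] by (simp add: s\<nu>)
    define e where "e = measure \<nu> {x. x $ i \<le> 0}"
    have "e = 0"
    proof (rule ccontr)
      assume "e \<noteq> 0"
      then have e: "0 < e" "e \<le> 1" by (auto simp: e_def zero_less_measure_iff)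
      \<comment> \<open>This choice yields \<open>t powr - lam * m i = 1 - ln e\<close>, so the
        marginal at \<open>t\<close> equals \<open>e / exp 1\<close>. It would have to be at least
        the mass \<open>e\<close> of the nonpositive half-line, a contradiction.\<close>
      define z where "z = (1 - ln e) / m i"
      define t where "t = z powr - (1 / lam)"
      have "ln e \<le> 0" using e by simp
      then have pos: "0 < z" using m[of i] by (simp add: z_def)
      then have t: "0 < t" unfolding t_def by simp
      have "t powr - lam = z"
        using pos lam by (simp add: t_def powr_powr)
      then have "t powr - lam * m i = 1 - ln e" using m[of i] by (simp add: z_def)
      moreover have "e \<le> measure \<nu> {x. x $ i \<le> t}"
        unfolding e_def using t bi by (intro \<nu>.finite_measure_mono) auto
      ultimately have "e \<le> exp (ln e - 1)" using marg0[OF t, of i] by simp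
      then show False using e by (simp add: exp_diff field_simps)
    qed
    then have "AE x in \<nu>. x \<notin> {x. x $ i \<le> 0}"
      using \<nu>.prob_eq_0[OF bi[of 0]] by (simp add: e_def)
    then show ?thesis by (simp add: not_le)
  qed
  then have pos: "AE x in \<nu>. \<forall>i. 0 < x $ i" by (simp add: AE_all_countable)
  have "converges_in_law (\<lambda>n. scaled_max_law mu n (s n)) \<nu>"
  proof (rule converges_in_law_if_cdf_converges[OF _ p\<nu> _ s\<nu> _ pos])
    show "prob_space (scaled_max_law mu n (s n))" for n
      by (rule prob_space_scaled_max_law) (simp_all add: mu.prob_space_axioms)
    show "(\<lambda>n. measure (scaled_max_law mu n (s n)) {x. \<forall>i. x $ i \<le> w i})
      \<longlonglongrightarrow> measure \<nu> {x. \<forall>i. x $ i \<le> w i}" if w: "\<And>i. 0 < w i" for w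
      using scaled_max_cdf_tendsto[OF s w] \<nu>[of UNIV w] w by simp
  qed simp
  then have "frechet_max_limit mu lam s a \<nu>"
    unfolding frechet_max_limit_def using s(1) a p\<nu> s\<nu> marg by blast
  moreover have "is_exponent_measure (gauge_measure_pos D lam 1) \<nu>"
    unfolding is_exponent_measure_def
  proof (intro allI impI)
    fix w :: "real^'d" assume w: "\<forall>i. 0 < w $ i"
    have eq: "emeasure (gauge_measure_pos D lam 1) ({0..} - {0..w}) = emeasure rho {x. \<exists>i\<in>UNIV. w $ i < x $ i}"
      by (rule gauge_measure_pos_eq_rho) (use w in simp)
    have "{..w} = {x. \<forall>i\<in>UNIV. x $ i \<le> w $ i}" by (auto simp: less_eq_vec_def)
    then show "emeasure (gauge_measure_pos D lam 1) ({0..} - {0..w}) < \<infinity> \<and>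
      measure \<nu> {..w} = exp (- measure (gauge_measure_pos D lam 1) ({0..} - {0..w}))"
      using eq upper_orthant_limit(2)[of UNIV "\<lambda>i. w $ i"] \<nu>[of UNIV "\<lambda>i. w $ i"] w
      by (simp add: measure_def)
  qed
  ultimately show ?thesis by blast
qed

text \<open>With \<open>s = \<P>{X\<^sub>i > t}\<close>, the \<open>(1 - s)\<close>-quantile of \<open>X\<^sub>j\<close> is at most \<open>C t\<close> for a suitable constant \<open>C\<close>,
  so \<open>P(1 - s, 1 - s) \<ge> \<P>{X\<^sub>i > C t, X\<^sub>j > C t}\<close>, which is of the same order as \<open>s\<close>.\<close>

lemma not_asymp_indep:
  fixes X :: "'c \<Rightarrow> real^'d"
  assumes M: "prob_space M" and X [measurable]: "X \<in> borel_measurable M" and law: "distr M borel X = mu"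
    and x: "x \<in> D" "0 < x $ i" "0 < x $ j"
  shows "\<not> asymp_indep M (\<lambda>\<omega>. X \<omega> $ i) (\<lambda>\<omega>. X \<omega> $ j)"
proof
  assume "asymp_indep M (\<lambda>\<omega>. X \<omega> $ i) (\<lambda>\<omega>. X \<omega> $ j)"
  then obtain P where P: "\<And>u v. P (cdf (distr M borel (\<lambda>\<omega>. X \<omega> $ i)) u) (cdf (distr M borel (\<lambda>\<omega>. X \<omega> $ j)) v)
      = measure M {\<omega> \<in> space M. u < X \<omega> $ i \<and> v < X \<omega> $ j}"
    and o: "(\<lambda>s. P (1 - s) (1 - s)) \<in> o[at_right 0](\<lambda>s. s)"
    unfolding asymp_indep_def by blast
  define F where "F k = cdf (distr mu borel (\<lambda>x. x $ k))" for k
  define p where "p k t = measure mu {x. t < x $ k}" for k t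
  have F: "F k t = 1 - p k t" for k t
    by (simp add: F_def p_def cdf_coordinate mu_coordinate_cdf)
  have dist_X: "distr M borel (\<lambda>\<omega>. X \<omega> $ k) = distr mu borel (\<lambda>x. x $ k)" for k
    unfolding law[symmetric] by (subst distr_distr) (auto simp: comp_def)
  have jm: "{x :: real^'d. u < x $ i \<and> v < x $ j} \<in> sets borel" for u v by measurable
  have P': "P (F i u) (F j v) = measure mu {x. u < x $ i \<and> v < x $ j}" for u v
  proof -
    have "measure mu {x. u < x $ i \<and> v < x $ j} = measure M {\<omega> \<in> space M. u < X \<omega> $ i \<and> v < X \<omega> $ j}"
      unfolding law[symmetric] using jm
      by (subst measure_distr) (auto intro!: arg_cong[where f="measure M"])
    then show ?thesis using P[of u v] by (simp add: F_def dist_X)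
  qed
  define mi mj where "mi = measure rho {x. 1 < x $ i}" and "mj = measure rho {x. 1 < x $ j}"
  have mi: "0 < mi" and mj: "0 < mj" by (simp_all add: mi_def mj_def coordinate_mass_pos)
  \<comment> \<open>The power makes \<open>C powr - lam * mj\<close> at most \<open>mi / 2\<close>,
    so the tail of the \<open>j\<close>-th coordinate at \<open>t * C\<close> is eventually below
    that of the \<open>i\<close>-th at \<open>t\<close>. The bound \<open>1 \<le> C\<close> gives
    \<open>t \<le> t * C\<close> for the final inclusion of events.\<close>
  define C where "C = max 1 ((2 * mj / mi) powr (1 / lam))"
  have C: "1 \<le> C" by (simp add: C_def)
  have "(2 * mj / mi) = ((2 * mj / mi) powr (1 / lam)) powr lam"
    using mi mj lam by (simp add: powr_powr)
  also have "\<dots> \<le> C powr lam" using lam by (intro powr_mono2) (auto simp: C_def)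
  finally have "2 * mj \<le> C powr lam * mi" using mi by (simp add: divide_le_eq)
  then have "mj < mi * C powr lam" using mj by (simp add: mult.commute)
  moreover have "0 < C powr lam" using C by simp
  ultimately have C_lam: "C powr - lam * mj < mi"
    by (simp add: powr_minus_divide divide_less_eq)
  let ?J = "\<lambda>c. {x :: real^'d. c < x $ i \<and> c < x $ j}"
  define mC where "mC = measure rho (?J C)"
  have nrm: "1 \<le> norm y" if "y \<in> ?J C" for y :: "real^'d"
    using that C component_le_norm_cart[of y i] by auto
  have Jlim: "((\<lambda>t. measure mu (?J (t * C)) / tau t) \<longlongrightarrow> mC) at_top"
    unfolding mC_def
  proof (rule Lim_transform_eventually[OF tail_limit(1)[OF jm zero_less_one nrm]])
    show "\<forall>\<^sub>F t in at_top. measure mu {x. (1 / t) *\<^sub>R x \<in> ?J C} / tau t = measure mu (?J (t * C)) / tau t"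
      using eventually_gt_at_top[of 0]
    proof eventually_elim
      case (elim t)
      then have "{x. (1 / t) *\<^sub>R x \<in> ?J C} = ?J (t * C)" by (auto simp: field_simps)
      then show ?case by simp
    qed
  qed
  have mC: "0 < mC"
  proof -
    obtain m where m: "0 < m" "m \<le> x $ i" "m \<le> x $ j"
      using x by (metis min.cobounded1 min.cobounded2 min_less_iff_conj)
    have "open (?J C)" by (intro open_Collect_conj open_Collect_less continuous_intros)
    \<comment> \<open>As \<open>m\<close> bounds both coordinates from below, this multiple has both
      at least \<open>2 * C\<close>.\<close>
    moreover have "(2 * C / m) *\<^sub>R x \<in> ?J C \<inter> cone_of D"
    proof -
      have "C < 2 * C / m * x $ k" if "m \<le> x $ k" for k
      proof -
        have "C < 2 * C / m * m" using m C by simp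
        also have "\<dots> \<le> 2 * C / m * x $ k" using that m C by (intro mult_left_mono) auto
        finally show ?thesis .
      qed
      moreover have "x \<in> cone_of D" using x mem_cone_iff[of x] by (auto intro!: exI[of _ 1])
      ultimately show ?thesis using cone_scale[of "2 * C / m" x] m C by simp
    qed
    ultimately have "0 < emeasure rho (?J C)" by (intro rho_open_pos) blast+
    moreover have "emeasure rho (?J C) < \<infinity>" by (rule tail_limit(2)[OF jm zero_less_one nrm])
    ultimately show ?thesis by (simp add: mC_def measure_def enn2real_positive_iff)
  qed
  have ilim: "((\<lambda>t. p i t / tau t) \<longlongrightarrow> mi) at_top"
    using coordinate_limit[of 1 i] by (simp add: p_def mi_def)
  have jlim: "((\<lambda>t. p j (t * C) / tau t) \<longlongrightarrow> C powr - lam * mj) at_top"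
    using coordinate_limit[of C j] rho_coordinate_scale[of C j] C by (simp add: p_def mj_def)
  have pi0: "((\<lambda>t. p i t) \<longlongrightarrow> 0) at_top"
    unfolding p_def by (rule coordinate_tail_to_zero)
  have ev_pos: "\<forall>\<^sub>F t in at_top. 0 < p i t"
    using order_tendstoD(1)[OF ilim mi] eventually_gt_at_top[of 0]
  proof eventually_elim
    case (elim t)
    then show ?case using tau_pos[of t] by (simp add: zero_less_divide_iff)
  qed
  have ri: "filterlim (p i) (at_right 0) at_top"
    using pi0 ev_pos by (intro tendsto_imp_filterlim_at_right) auto
  \<comment> \<open>Balanced so that \<open>c * (2 * mi * tau t) = mC / 2 * tau t\<close>, which
    lies below the joint tail at \<open>t * C\<close> for large \<open>t\<close>.\<close>
  define c where "c = mC / (4 * mi)"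
  have c: "0 < c" using mi mC by (simp add: c_def)
  have "\<forall>\<^sub>F s in at_right 0. norm (P (1 - s) (1 - s)) \<le> c * norm s"
    by (rule landau_o.smallD[OF o c])
  then have evP: "\<forall>\<^sub>F t in at_top. norm (P (1 - p i t) (1 - p i t)) \<le> c * norm (p i t)"
    using ri by (rule eventually_compose_filterlim)
  have ev_ij: "\<forall>\<^sub>F t in at_top. 0 < p i t / tau t - p j (t * C) / tau t"
    by (rule order_tendstoD(1)[OF tendsto_diff[OF ilim jlim]]) (use C_lam in simp)
  have ev_i: "\<forall>\<^sub>F t in at_top. p i t / tau t < 2 * mi"
    by (rule order_tendstoD[OF ilim]) (use mi in simp)
  have ev_J: "\<forall>\<^sub>F t in at_top. mC / 2 < measure mu (?J (t * C)) / tau t"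
    by (rule order_tendstoD[OF Jlim]) (use mC in simp)
  have "\<forall>\<^sub>F t :: real in at_top. False"
    using evP ev_ij ev_pos order_tendstoD(2)[OF pi0 zero_less_one] eventually_gt_at_top[of 0] ev_i ev_J
  proof eventually_elim
    case (elim t)
    have tau: "0 < tau t" by (rule tau_pos) (rule elim)
    have "p j (t * C) < p i t" using elim(2) tau by (simp add: divide_simps)
    then have hi: "1 - p i t \<le> F j (t * C)" by (simp add: F)
    interpret Fj: real_distribution "distr mu borel (\<lambda>x. x $ j)" by (rule coordinate_distribution)
    have "\<forall>\<^sub>F y in at_bot. F j y < 1 - p i t"
      unfolding F_def by (rule order_tendstoD[OF Fj.cdf_lim_at_bot]) (use elim in simp)
    then obtain b where b: "\<And>y. y \<le> b \<Longrightarrow> F j y < 1 - p i t"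
      by (auto simp: eventually_at_bot_linorder)
    \<comment> \<open>\<open>P\<close> is prescribed only at pairs of marginal values. Continuity
      provides \<open>y\<close> with \<open>F j y = F i t\<close>, so that a joint probability
      evaluates \<open>P\<close> on the diagonal.\<close>
    have "isCont (F j) y" for y
    proof -
      have "(\<lambda>x. x $ j) -` {y} \<inter> space mu = {x :: real^'d. x $ j = y}" by auto
      then have "measure (distr mu borel (\<lambda>x. x $ j)) {y} = 0"
        by (subst measure_distr) (auto simp: mu_hyperplane_null)
      then show ?thesis unfolding F_def by (simp add: Fj.isCont_cdf)
    qed
    then have "\<exists>y\<ge>min b (t * C). y \<le> t * C \<and> F j y = 1 - p i t"
      using hi b[of "min b (t * C)"]
      by (intro IVT') (auto intro: continuous_at_imp_continuous_on)
    then obtain y where y: "y \<le> t * C" "F j y = 1 - p i t" by blast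
    have tC: "t \<le> t * C" using C elim(5) by simp
    have "measure mu (?J (t * C)) \<le> measure mu {x. t < x $ i \<and> y < x $ j}"
      using y tC jm by (intro mu.finite_measure_mono) auto
    also have "\<dots> = P (1 - p i t) (1 - p i t)" using P'[of t y] y by (simp add: F)
    also have "\<dots> \<le> c * p i t" using elim(1,3) by simp
    also have "\<dots> < c * (2 * mi * tau t)"
      using c elim(6) mi tau by (intro mult_strict_left_mono) (auto simp: divide_less_eq)
    also have "\<dots> = mC / 2 * tau t" using mi by (simp add: c_def)
    also have "\<dots> < measure mu (?J (t * C))" using elim(7) mC tau by (simp add: less_divide_eq)
    finally show False .
  qed
  then obtain N :: real where "\<forall>n\<ge>N. False" by (auto simp only: eventually_at_top_linorder)
  then show False by blast
qed

end

theorem theorem3p12: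
  fixes M :: "'a measure"
    and X :: "'a \<Rightarrow> real ^ 'd"
    and D :: "(real ^ 'd) set"
    and f :: "real ^ 'd \<Rightarrow> real"
    and f0 :: "real \<Rightarrow> real"
    and lam :: real
  assumes D: "D \<in> shape_class"
    and lambda_pos: "0 < lam"
    and f0_cont: "continuous_on {0..} f0"
    and f0_decr: "strict_antimono_on {0..} f0"
    and f0_pos: "\<forall>t\<ge>0. 0 < f0 t"
    and f0_rv: "regularly_varying f0 (- (lam + real CARD('d)))"
    and M: "prob_space M"
    and f_nonneg: "\<forall>x. 0 \<le> f x"
    and X_density: "distributed M lborel X (\<lambda>x. ennreal (f x))"
    and f_asymp: "asymp_to_gauge f f0 D"
    and D_pos: "\<forall>i. \<exists>x\<in>D. 0 < x $ i"
  shows "(\<not> D \<subseteq> {x. card {i. 0 < x $ i} \<le> 1} \<longrightarrow> asymp_dep_components M X)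
    \<and> (\<exists>s a \<nu> c. 0 < c \<and> frechet_max_limit (distr M borel X) lam s a \<nu>
          \<and> is_exponent_measure (gauge_measure_pos D lam c) \<nu>)
    \<and> (\<exists>s a \<nu>. frechet_max_limit (distr M borel X) lam s a \<nu>
          \<and> is_exponent_measure (gauge_measure_pos D lam 1) \<nu>)"
proof -
  have X: "X \<in> borel_measurable M"
    using X_density by (simp add: distributed_def)
  have law: "distr M borel X = density lborel (\<lambda>x. ennreal (f x))"
    using X_density by (simp add: distributed_def cong: distr_cong)
  have fm: "f \<in> borel_measurable borel"
  proof -
    have "(\<lambda>x. ennreal (f x)) \<in> borel_measurable borel"
      using X_density by (simp add: distributed_def)
    then have "(\<lambda>x. enn2real (ennreal (f x))) \<in> borel_measurable borel" by measurable
    then show ?thesis using f_nonneg by simp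
  qed
  have "prob_space (density lborel (\<lambda>x. ennreal (f x)))"
    unfolding law[symmetric] by (rule prob_space.prob_space_distr[OF M X])
  then interpret max_setting D lam f f0
    by (intro max_setting.intro max_setting_axioms.intro tail_setting.intro tail_setting_axioms.intro
      gauge_setting.intro) (use assms fm in auto)
  have mu: "distr M borel X = mu" by (simp add: law mu_def)
  have "asymp_dep_components M X" if dep: "\<not> D \<subseteq> {x. card {i. 0 < x $ i} \<le> 1}"
  proof -
    obtain x where x: "x \<in> D" "\<not> card {i. 0 < x $ i} \<le> 1" using dep by blast
    then obtain i j where "i \<noteq> j" "0 < x $ i" "0 < x $ j"
      using card_le_Suc0_iff_eq[of "{i. 0 < x $ i}"] by auto
    then show ?thesis
      unfolding asymp_dep_components_def asymp_indep_components_def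
      using not_asymp_indep[OF M X mu x(1)] by blast
  qed
  moreover have "\<exists>s a \<nu>. frechet_max_limit (distr M borel X) lam s a \<nu>
      \<and> is_exponent_measure (gauge_measure_pos D lam 1) \<nu>"
    unfolding mu by (rule frechet_limit_exists)
  \<comment> \<open>The claim with an unspecified positive constant is witnessed by
    \<open>c = 1\<close>.\<close>
  ultimately show ?thesis using zero_less_one by blast
qed

end
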